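(* The extension $\widetilde\lambda_f\in\mathrm{Aut}(\mathcal{Q}_2)$ of the flip-flop, given by $\widetilde\lambda_f(U)=U^*$ and $\widetilde\lambda_f(S_2)=US_2$, is an outer automorphism of $\mathcal{Q}_2$.
   Context: The $2$-adic ring $C^*$-algebra $\mathcal{Q}_2$ is the universal (unital) $C^*$-algebra generated by a unitary $U$ and an isometry $S_2$ satisfying $S_2U=U^2S_2$ and $S_2S_2^*+US_2S_2^*U^*=1$. Put $S_1:=US_2$. The Cuntz algebra $\mathcal{O}_2$ is regarded as the $C^*$-subalgebra $C^*(S_1,S_2)\subset\mathcal{Q}_2$, and the flip-flop is the automorphism of $\mathcal{O}_2$ exchanging $S_1$ and $S_2$; it extends to the automorphism $\widetilde\lambda_f$ of $\mathcal{Q}_2$. An automorphism is outer if it is not of the form $x\mapsto wxw^*$ for a unitary $w\in\mathcal{Q}_2$. *)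

theory Defs
  imports "HOL-Analysis.Analysis" "HOL-Library.Poly_Mapping"
begin

section \<open>Unital C*-algebras\<close>

class scaleC =
  fixes scaleC :: "complex \<Rightarrow> 'a \<Rightarrow> 'a" (infixr \<open>*\<^sub>C\<close> 75)

class star =
  fixes star :: "'a \<Rightarrow> 'a"

text \<open>The zero algebra is allowed, hence \<open>monoid_mult\<close> instead of \<open>ring_1\<close>
  (which would require \<open>0 \<noteq> 1\<close>).\<close>

class unital_cstar_algebra = real_normed_algebra + monoid_mult + banach + scaleC + star +
  assumes scaleC_add_right: "a *\<^sub>C (x + y) = a *\<^sub>C x + a *\<^sub>C y"
    and scaleC_add_left: "(a + b) *\<^sub>C x = a *\<^sub>C x + b *\<^sub>C x"
    and scaleC_scaleC: "a *\<^sub>C b *\<^sub>C x = (a * b) *\<^sub>C x"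
    and scaleR_scaleC: "r *\<^sub>R x = complex_of_real r *\<^sub>C x"
    and mult_scaleC_left: "a *\<^sub>C x * y = a *\<^sub>C (x * y)"
    and mult_scaleC_right: "x * a *\<^sub>C y = a *\<^sub>C (x * y)"
    and norm_scaleC: "norm (a *\<^sub>C x) = cmod a * norm x"
    and star_add: "star (x + y) = star x + star y"
    and star_scaleC: "star (a *\<^sub>C x) = cnj a *\<^sub>C star x"
    and star_mult: "star (x * y) = star y * star x"
    and star_star: "star (star x) = x"
    and cstar_identity: "norm (star x * x) = (norm x)\<^sup>2"

definition unitary :: "'a::unital_cstar_algebra \<Rightarrow> bool" where
  "unitary w \<longleftrightarrow> star w * w = 1 \<and> w * star w = 1"

definition isometry :: "'a::unital_cstar_algebra \<Rightarrow> bool" where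
  "isometry s \<longleftrightarrow> star s * s = 1"

definition star_subalgebra :: "'a::unital_cstar_algebra set \<Rightarrow> bool" where
  "star_subalgebra A \<longleftrightarrow> 1 \<in> A \<and>
     (\<forall>x\<in>A. \<forall>y\<in>A. x + y \<in> A \<and> x * y \<in> A) \<and>
     (\<forall>x\<in>A. star x \<in> A \<and> (\<forall>c. c *\<^sub>C x \<in> A))"

definition cstar_generated :: "'a::unital_cstar_algebra set \<Rightarrow> 'a set" where
  "cstar_generated X = \<Inter>{A. star_subalgebra A \<and> closed A \<and> X \<subseteq> A}"

definition star_hom_on ::
  "'a::unital_cstar_algebra set \<Rightarrow> ('a \<Rightarrow> 'b::unital_cstar_algebra) \<Rightarrow> bool" where
  "star_hom_on A f \<longleftrightarrow> f 1 = 1 \<and>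
     (\<forall>x\<in>A. \<forall>y\<in>A. f (x + y) = f x + f y \<and> f (x * y) = f x * f y) \<and>
     (\<forall>x\<in>A. f (star x) = star (f x) \<and> (\<forall>c. f (c *\<^sub>C x) = c *\<^sub>C f x))"

definition star_automorphism_on :: "'a::unital_cstar_algebra set \<Rightarrow> ('a \<Rightarrow> 'a) \<Rightarrow> bool" where
  "star_automorphism_on A f \<longleftrightarrow> star_hom_on A f \<and> bij_betw f A A"

abbreviation star_automorphism :: "('a::unital_cstar_algebra \<Rightarrow> 'a) \<Rightarrow> bool" where
  "star_automorphism \<equiv> star_automorphism_on UNIV"

definition inner_automorphism :: "('a::unital_cstar_algebra \<Rightarrow> 'a) \<Rightarrow> bool" where
  "inner_automorphism f \<longleftrightarrow> (\<exists>w. unitary w \<and> (\<forall>x. f x = w * x * star w))"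

definition outer_automorphism :: "('a::unital_cstar_algebra \<Rightarrow> 'a) \<Rightarrow> bool" where
  "outer_automorphism f \<longleftrightarrow> star_automorphism f \<and> \<not> inner_automorphism f"

section \<open>The free unital *-algebra on two generators\<close>

datatype gen = Gen_U | Gen_S

text \<open>The letter \<open>(g, False)\<close> is the generator \<open>g\<close>, and \<open>(g, True)\<close> is its adjoint.\<close>

datatype word = Word (letters: "(gen \<times> bool) list")

instantiation word :: monoid_add
begin

definition "0 = Word []"
definition "v + w = Word (letters v @ letters w)"

instance
  by standard (auto simp: zero_word_def plus_word_def)

end

definition wstar :: "word \<Rightarrow> word" where
  "wstar w = Word (rev (map (\<lambda>(g, b). (g, \<not> b)) (letters w)))"

lemma wstar_wstar [simp]: "wstar (wstar w) = w"
  by (cases w) (auto simp: wstar_def rev_map o_def split_beta)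

lemma wstar_add: "wstar (v + w) = wstar w + wstar v"
  by (auto simp: wstar_def plus_word_def)

lemma wstar_0 [simp]: "wstar 0 = 0"
  by (simp add: wstar_def zero_word_def)

text \<open>Elements are finitely supported functions on words; the product provided by
  \<^theory>\<open>HOL-Library.Poly_Mapping\<close> is convolution, i.e. concatenation of words.\<close>

type_synonym free = "word \<Rightarrow>\<^sub>0 complex"

definition fconst :: "complex \<Rightarrow> free" where
  "fconst c = Poly_Mapping.single 0 c"

definition fgen :: "gen \<Rightarrow> free" where
  "fgen g = Poly_Mapping.single (Word [(g, False)]) 1"

lift_definition fstar :: "free \<Rightarrow> free" is "\<lambda>f w. cnj (f (wstar w))"
proof -
  fix f :: "word \<Rightarrow> complex" assume "finite {w. f w \<noteq> 0}"
  then have "finite (wstar ` {w. f w \<noteq> 0})" by simp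
  moreover have "{w. cnj (f (wstar w)) \<noteq> 0} \<subseteq> wstar ` {w. f w \<noteq> 0}"
  proof
    fix w assume "w \<in> {w. cnj (f (wstar w)) \<noteq> 0}"
    then show "w \<in> wstar ` {w. f w \<noteq> 0}" by (intro image_eqI [of _ _ "wstar w"]) auto
  qed
  ultimately show "finite {w. cnj (f (wstar w)) \<noteq> 0}" by (rule rev_finite_subset)
qed

lemma free_induct [case_names single add]:
  fixes f :: free
  assumes s: "\<And>w c. P (Poly_Mapping.single w c)"
    and a: "\<And>f g. P f \<Longrightarrow> P g \<Longrightarrow> P (f + g)"
  shows "P f"
proof (induction f rule: Poly_Mapping.update_induct)
  case const
  then show ?case using s [of 0 0] by simp
next
  case (update f w c)
  have "Poly_Mapping.update w c f = f + Poly_Mapping.single w c"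
    using update(1)
    by (intro poly_mapping_eqI)
      (auto simp: lookup_add lookup_update lookup_single when_def in_keys_iff)
  then show ?case using a update s by simp
qed

lemma fstar_single [simp]:
  "fstar (Poly_Mapping.single w c) = Poly_Mapping.single (wstar w) (cnj c)"
  by transfer (auto simp: fun_eq_iff when_def)

lemma fstar_add: "fstar (x + y) = fstar x + fstar y"
  by transfer (simp add: fun_eq_iff)

lemma fstar_uminus: "fstar (- x) = - fstar x"
  by transfer (simp add: fun_eq_iff)

lemma fstar_diff: "fstar (x - y) = fstar x - fstar y"
  using fstar_add [of x "- y"] by (simp add: fstar_uminus)

lemma fstar_fstar [simp]: "fstar (fstar x) = x"
  by transfer (simp add: fun_eq_iff)

lemma fstar_mult: "fstar (x * y) = fstar y * fstar x"
proof (induction x rule: free_induct)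
  case (single w c)
  show ?case
    by (induction y rule: free_induct)
      (simp_all add: mult_single wstar_add ring_distribs fstar_add mult.commute)
qed (simp add: ring_distribs fstar_add)

lemma fconst_comm: "fconst c * x = x * fconst c"
  by (induction x rule: free_induct)
    (simp_all add: fconst_def mult_single ring_distribs mult.commute)

lemma fstar_fconst [simp]: "fstar (fconst c) = fconst (cnj c)"
  by (simp add: fconst_def)

lemma fstar_fconst_mult: "fstar (fconst c * x) = fconst (cnj c) * fstar x"
  by (simp add: fstar_mult fconst_comm)

lemma fconst_add: "fconst (a + b) = fconst a + fconst b"
  by (simp add: fconst_def single_add)

lemma fconst_mult: "fconst (a * b) = fconst a * fconst b"
  by (simp add: fconst_def mult_single)

lemma fconst_0 [simp]: "fconst 0 = 0" and fconst_1 [simp]: "fconst 1 = 1"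
  by (simp_all add: fconst_def)

lemma fconst_minus_1: "fconst (- 1) = - 1"
  by (simp add: fconst_def single_uminus)

section \<open>The 2-adic ring C*-algebra\<close>

definition q2_relators :: "free set" where
  "q2_relators = (let U = fgen Gen_U; S = fgen Gen_S in
     {fstar U * U - 1, U * fstar U - 1, fstar S * S - 1,
      S * U - U\<^sup>2 * S,
      S * fstar S + U * S * fstar S * fstar U - 1})"

definition q2_seminorm :: "(free \<Rightarrow> real) \<Rightarrow> bool" where
  "q2_seminorm p \<longleftrightarrow>
     (\<forall>x y. p (x + y) \<le> p x + p y) \<and>
     (\<forall>c x. p (fconst c * x) = cmod c * p x) \<and>
     (\<forall>x y. p (x * y) \<le> p x * p y) \<and>
     (\<forall>x. p (fstar x * x) = (p x)\<^sup>2) \<and>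
     (\<forall>r\<in>q2_relators. p r = 0)"

text \<open>The universal C*-algebra of the relations is the Hausdorff completion of the free
  *-algebra with respect to the largest C*-seminorm that vanishes on the relators.\<close>

definition q2_norm :: "free \<Rightarrow> real" where
  "q2_norm x = (SUP p \<in> {p. q2_seminorm p}. p x)"

lemma q2_seminormD:
  assumes "q2_seminorm p"
  shows "p (x + y) \<le> p x + p y" "p (fconst c * x) = cmod c * p x" "p (x * y) \<le> p x * p y"
    "p (fstar x * x) = (p x)\<^sup>2" "r \<in> q2_relators \<Longrightarrow> p r = 0"
  using assms by (auto simp: q2_seminorm_def)

lemma q2_seminorm_basic:
  assumes "q2_seminorm p"
  shows "p 0 = 0" "p (- x) = p x" "0 \<le> p x" "p (fstar x) = p x" "p (x - y) \<le> p x + p y"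
proof -
  note D = q2_seminormD [OF assms]
  show 0: "p 0 = 0" using D(2) [of 0 0] by simp
  show m: "p (- x) = p x" for x using D(2) [of "-1" x] by (simp add: fconst_minus_1)
  show pos: "0 \<le> p x" for x using D(1) [of x "- x"] by (simp add: 0 m)
  have le: "p x \<le> p (fstar x)" for x
  proof (cases "p x = 0")
    case False
    then have "p x > 0" using pos [of x] by linarith
    moreover have "p x * p x \<le> p (fstar x) * p x"
      using D(3) [of "fstar x" x] D(4) [of x] by (simp add: power2_eq_square)
    ultimately show ?thesis by simp
  qed (simp add: pos)
  show "p (fstar x) = p x" using le [of x] le [of "fstar x"] by simp
  show "p (x - y) \<le> p x + p y" using D(1) [of x "- y"] by (simp add: m)
qed

lemma q2_seminorm_one:
  assumes "q2_seminorm p" shows "p 1 \<le> 1"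
proof -
  have "fstar 1 = 1" using fstar_fconst [of 1] by simp
  then have "p 1 = (p 1)\<^sup>2" using q2_seminormD(4) [OF assms, of 1] by simp
  then show ?thesis by (auto simp: power2_eq_square)
qed

lemma q2_seminorm_gen:
  assumes "q2_seminorm p" shows "p (fgen g) \<le> 1"
proof -
  have "fstar (fgen g) * fgen g - 1 \<in> q2_relators"
    by (cases g) (auto simp: q2_relators_def Let_def)
  then have "p (fstar (fgen g) * fgen g - 1) = 0" using q2_seminormD(5) [OF assms] by blast
  then have "(p (fgen g))\<^sup>2 \<le> 0 + p 1"
    using q2_seminormD(1) [OF assms, of "fstar (fgen g) * fgen g - 1" 1] q2_seminormD(4) [OF assms]
    by simp
  also have "\<dots> \<le> 1" using q2_seminorm_one [OF assms] by simp
  finally show ?thesis by (simp add: power2_le_imp_le)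
qed

lemma q2_seminorm_word:
  assumes "q2_seminorm p" shows "p (Poly_Mapping.single (Word l) 1) \<le> 1"
proof (induction l)
  case Nil
  then show ?case using q2_seminorm_one [OF assms]
    by (simp add: zero_word_def [symmetric])
next
  case (Cons a l)
  obtain g b where a: "a = (g, b)" by force
  have "Poly_Mapping.single (Word [a]) 1 = (if b then fstar (fgen g) else fgen g)"
    by (auto simp: a fgen_def wstar_def)
  then have 1: "p (Poly_Mapping.single (Word [a]) 1) \<le> 1"
    using q2_seminorm_gen [OF assms] q2_seminorm_basic(4) [OF assms] by auto
  have "Poly_Mapping.single (Word (a # l)) (1::complex)
      = Poly_Mapping.single (Word [a]) 1 * Poly_Mapping.single (Word l) 1"
    by (simp add: mult_single plus_word_def)
  then have "p (Poly_Mapping.single (Word (a # l)) 1)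
      \<le> p (Poly_Mapping.single (Word [a]) 1) * p (Poly_Mapping.single (Word l) 1)"
    using q2_seminormD(3) [OF assms] by simp
  also have "\<dots> \<le> 1 * 1"
    by (rule mult_mono) (use 1 Cons q2_seminorm_basic(3) [OF assms] in auto)
  finally show ?case by simp
qed

lemma q2_seminorm_bounded: "\<exists>B. \<forall>p. q2_seminorm p \<longrightarrow> p x \<le> B"
proof (induction x rule: free_induct)
  case (single w c)
  have "p (Poly_Mapping.single w c) \<le> cmod c" if p: "q2_seminorm p" for p
  proof -
    have "Poly_Mapping.single w c = fconst c * Poly_Mapping.single w 1"
      by (simp add: fconst_def mult_single)
    then have "p (Poly_Mapping.single w c) = cmod c * p (Poly_Mapping.single w 1)"
      using q2_seminormD(2) [OF p] by simp
    also have "\<dots> \<le> cmod c * 1"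
      using q2_seminorm_word [OF p, of "letters w"] by (intro mult_left_mono) auto
    finally show ?thesis by simp
  qed
  then show ?case by blast
next
  case (add f g)
  then obtain B C where "\<forall>p. q2_seminorm p \<longrightarrow> p f \<le> B" "\<forall>p. q2_seminorm p \<longrightarrow> p g \<le> C"
    by blast
  then have "\<forall>p. q2_seminorm p \<longrightarrow> p (f + g) \<le> B + C"
    by (meson add_mono order_trans q2_seminormD(1))
  then show ?case by blast
qed

lemma q2_seminorm_zero: "q2_seminorm (\<lambda>_. 0)"
  by (simp add: q2_seminorm_def)

lemma q2_norm_upper: "q2_seminorm p \<Longrightarrow> p x \<le> q2_norm x"
  unfolding q2_norm_def using q2_seminorm_bounded [of x]
  by (intro cSUP_upper) (auto simp: bdd_above_def)

lemma q2_norm_least: "(\<And>p. q2_seminorm p \<Longrightarrow> p x \<le> B) \<Longrightarrow> q2_norm x \<le> B"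
  unfolding q2_norm_def using q2_seminorm_zero by (intro cSUP_least) auto

lemma q2_norm_ge_0: "0 \<le> q2_norm x"
  using q2_norm_upper [OF q2_seminorm_zero] .

lemma q2_norm_seminorm: "q2_seminorm q2_norm"
  unfolding q2_seminorm_def
proof (intro conjI allI ballI)
  note up = q2_norm_upper and pos = q2_norm_ge_0
  fix x y :: free and c :: complex
  show "q2_norm (x + y) \<le> q2_norm x + q2_norm y"
    by (rule q2_norm_least) (meson up add_mono order_trans q2_seminormD(1))
  show "q2_norm (x * y) \<le> q2_norm x * q2_norm y"
  proof (rule q2_norm_least)
    fix p assume p: "q2_seminorm p"
    have "p (x * y) \<le> p x * p y" using q2_seminormD(3) [OF p] .
    also have "\<dots> \<le> q2_norm x * q2_norm y"
      using up [OF p] q2_seminorm_basic(3) [OF p] pos by (intro mult_mono) auto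
    finally show "p (x * y) \<le> q2_norm x * q2_norm y" .
  qed
  have le: "q2_norm (fconst c * x) \<le> cmod c * q2_norm x" for c x
    by (rule q2_norm_least) (simp add: q2_seminormD(2) up mult_left_mono)
  show "q2_norm (fconst c * x) = cmod c * q2_norm x"
  proof (cases "c = 0")
    case True
    then show ?thesis using le [of 0 x] pos [of 0] by simp
  next
    case False
    have "x = fconst (inverse c) * (fconst c * x)"
      using False by (simp add: mult.assoc [symmetric] fconst_mult [symmetric])
    then have "q2_norm x \<le> cmod (inverse c) * q2_norm (fconst c * x)"
      using le by metis
    then have "cmod c * q2_norm x \<le> q2_norm (fconst c * x)"
      using False by (simp add: norm_inverse norm_divide field_simps)
    then show ?thesis using le [of c x] by simp
  qed
  show "q2_norm (fstar x * x) = (q2_norm x)\<^sup>2"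
  proof (rule antisym)
    show "q2_norm (fstar x * x) \<le> (q2_norm x)\<^sup>2"
    proof (rule q2_norm_least)
      fix p assume p: "q2_seminorm p"
      show "p (fstar x * x) \<le> (q2_norm x)\<^sup>2"
        using up [OF p, of x] q2_seminorm_basic(3) [OF p, of x] q2_seminormD(4) [OF p, of x]
        by (simp add: power_mono)
    qed
    have "q2_norm x \<le> sqrt (q2_norm (fstar x * x))"
    proof (rule q2_norm_least)
      fix p assume p: "q2_seminorm p"
      show "p x \<le> sqrt (q2_norm (fstar x * x))"
        using up [OF p, of "fstar x * x"] q2_seminormD(4) [OF p, of x]
        by (simp add: real_le_rsqrt)
    qed
    then show "(q2_norm x)\<^sup>2 \<le> q2_norm (fstar x * x)"
      using pos by (metis power_mono real_sqrt_pow2)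
  qed
next
  fix r assume "r \<in> q2_relators"
  then have "q2_norm r \<le> 0" by (intro q2_norm_least) (simp add: q2_seminormD(5))
  then show "q2_norm r = 0" using q2_norm_ge_0 [of r] by simp
qed

lemmas q2_norm_add = q2_seminormD(1) [OF q2_norm_seminorm]
  and q2_norm_fconst = q2_seminormD(2) [OF q2_norm_seminorm]
  and q2_norm_mult = q2_seminormD(3) [OF q2_norm_seminorm]
  and q2_norm_cstar = q2_seminormD(4) [OF q2_norm_seminorm]
  and q2_norm_relators = q2_seminormD(5) [OF q2_norm_seminorm]
  and q2_norm_0 [simp] = q2_seminorm_basic(1) [OF q2_norm_seminorm]
  and q2_norm_uminus = q2_seminorm_basic(2) [OF q2_norm_seminorm]
  and q2_norm_fstar = q2_seminorm_basic(4) [OF q2_norm_seminorm]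
  and q2_norm_diff = q2_seminorm_basic(5) [OF q2_norm_seminorm]

lemma q2_norm_minus_commute: "q2_norm (x - y) = q2_norm (y - x)"
  using q2_norm_uminus [of "x - y"] by simp

lemma q2_norm_triangle_sub: "\<bar>q2_norm x - q2_norm y\<bar> \<le> q2_norm (x - y)"
  using q2_norm_add [of "x - y" y] q2_norm_add [of "y - x" x] q2_norm_minus_commute [of x y]
  by simp

subsection \<open>Completion by Cauchy sequences\<close>

definition q2_Cauchy :: "(nat \<Rightarrow> free) \<Rightarrow> bool" where
  "q2_Cauchy X \<longleftrightarrow> (\<forall>e>0. \<exists>N. \<forall>m\<ge>N. \<forall>n\<ge>N. q2_norm (X m - X n) < e)"

definition q2_rel :: "(nat \<Rightarrow> free) \<Rightarrow> (nat \<Rightarrow> free) \<Rightarrow> bool" where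
  "q2_rel X Y \<longleftrightarrow> q2_Cauchy X \<and> q2_Cauchy Y \<and> (\<lambda>n. q2_norm (X n - Y n)) \<longlonglongrightarrow> 0"

lemma q2_Cauchy_const [simp]: "q2_Cauchy (\<lambda>_. x)"
  by (simp add: q2_Cauchy_def)

lemma q2_rel_refl: "q2_Cauchy X \<Longrightarrow> q2_rel X X"
  by (simp add: q2_rel_def)

lemma tendsto_0_le:
  fixes f g :: "nat \<Rightarrow> real"
  assumes "g \<longlonglongrightarrow> 0" "\<And>n. 0 \<le> f n" "\<And>n. f n \<le> g n"
  shows "f \<longlonglongrightarrow> 0"
  using tendsto_sandwich [of "\<lambda>_. 0" f sequentially g 0] assms by simp

quotient_type q2 = "nat \<Rightarrow> free" / partial: q2_rel
proof (rule part_equivpI)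
  show "\<exists>X. q2_rel X X" using q2_rel_refl q2_Cauchy_const by blast
  show "symp q2_rel" by (auto simp: symp_def q2_rel_def q2_norm_minus_commute)
  show "transp q2_rel"
  proof (rule transpI)
    fix X Y Z assume a: "q2_rel X Y" "q2_rel Y Z"
    have "(\<lambda>n. q2_norm (X n - Y n) + q2_norm (Y n - Z n)) \<longlonglongrightarrow> 0"
      using a tendsto_add [of _ "0::real" _ _ 0] by (auto simp: q2_rel_def)
    then have "(\<lambda>n. q2_norm (X n - Z n)) \<longlonglongrightarrow> 0"
    proof (rule tendsto_0_le)
      show "q2_norm (X n - Z n) \<le> q2_norm (X n - Y n) + q2_norm (Y n - Z n)" for n
        using q2_norm_add [of "X n - Y n" "Y n - Z n"] by simp
    qed (rule q2_norm_ge_0)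
    then show "q2_rel X Z" using a by (simp add: q2_rel_def)
  qed
qed

lemma q2_Cauchy_lipschitz:
  assumes X: "q2_Cauchy X" and C: "0 < C"
    and le: "\<And>m n. q2_norm (Y m - Y n) \<le> C * q2_norm (X m - X n)"
  shows "q2_Cauchy Y"
  unfolding q2_Cauchy_def
proof (intro allI impI)
  fix e :: real assume "e > 0"
  then obtain N where "\<forall>m\<ge>N. \<forall>n\<ge>N. q2_norm (X m - X n) < e / C"
    using X C unfolding q2_Cauchy_def by (meson divide_pos_pos)
  then have "C * q2_norm (X m - X n) < e" if "m \<ge> N" "n \<ge> N" for m n
    using that C by (simp add: field_simps)
  then show "\<exists>N. \<forall>m\<ge>N. \<forall>n\<ge>N. q2_norm (Y m - Y n) < e"
    using le order_le_less_trans by blast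
qed

lemma q2_Cauchy_lipschitz2:
  assumes X: "q2_Cauchy X" and Y: "q2_Cauchy Y" and C: "0 < C"
    and le: "\<And>m n. q2_norm (Z m - Z n) \<le> C * (q2_norm (X m - X n) + q2_norm (Y m - Y n))"
  shows "q2_Cauchy Z"
  unfolding q2_Cauchy_def
proof (intro allI impI)
  fix e :: real assume "e > 0"
  then have "e / C / 2 > 0" using C by simp
  then obtain N M where N: "\<forall>m\<ge>N. \<forall>n\<ge>N. q2_norm (X m - X n) < e / C / 2"
    and M: "\<forall>m\<ge>M. \<forall>n\<ge>M. q2_norm (Y m - Y n) < e / C / 2"
    using X Y unfolding q2_Cauchy_def by blast
  have "q2_norm (Z m - Z n) < e" if "m \<ge> max N M" "n \<ge> max N M" for m n
  proof -
    have "q2_norm (X m - X n) + q2_norm (Y m - Y n) < e / C / 2 + e / C / 2"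
      by (intro add_strict_mono) (use N M that in auto)
    then have "C * (q2_norm (X m - X n) + q2_norm (Y m - Y n)) < e"
      using C by (simp add: field_simps)
    then show ?thesis using le [of m n] by simp
  qed
  then show "\<exists>N. \<forall>m\<ge>N. \<forall>n\<ge>N. q2_norm (Z m - Z n) < e" by blast
qed

lemma q2_Cauchy_bounded:
  assumes "q2_Cauchy X" shows "\<exists>B>0. \<forall>n. q2_norm (X n) \<le> B"
proof -
  obtain N where N: "\<forall>m\<ge>N. \<forall>n\<ge>N. q2_norm (X m - X n) < 1"
    using assms unfolding q2_Cauchy_def by (meson zero_less_one)
  define M where "M = Max ((\<lambda>n. q2_norm (X n)) ` {..N})"
  have le: "q2_norm (X n) \<le> M" if "n \<le> N" for n
    using that unfolding M_def by (intro Max_ge) auto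
  have "q2_norm (X n) \<le> M + 1" for n
  proof (cases "n \<le> N")
    case False
    then have "q2_norm (X n - X N) < 1" using N by simp
    then show ?thesis
      using q2_norm_add [of "X n - X N" "X N"] le [of N] by simp
  qed (use le [of n] in simp)
  moreover have "M + 1 > 0" using le [of 0] q2_norm_ge_0 [of "X 0"] by simp
  ultimately show ?thesis by blast
qed

lemma q2_rel_lipschitz:
  assumes X: "q2_rel X X'" and C: "0 < C"
    and 1: "\<And>x y. q2_norm (f x - f y) \<le> C * q2_norm (x - y)"
  shows "q2_rel (\<lambda>n. f (X n)) (\<lambda>n. f (X' n))"
  unfolding q2_rel_def
proof (intro conjI)
  show "q2_Cauchy (\<lambda>n. f (X n))" "q2_Cauchy (\<lambda>n. f (X' n))"
    using X C 1 by (auto simp: q2_rel_def intro: q2_Cauchy_lipschitz)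
  have "(\<lambda>n. C * q2_norm (X n - X' n)) \<longlonglongrightarrow> 0"
    using X tendsto_mult_right_zero by (auto simp: q2_rel_def)
  then show "(\<lambda>n. q2_norm (f (X n) - f (X' n))) \<longlonglongrightarrow> 0"
    by (rule tendsto_0_le) (auto simp: q2_norm_ge_0 1)
qed

lemma q2_norm_mult_diff:
  assumes "q2_norm x \<le> B" "q2_norm y' \<le> B"
  shows "q2_norm (x * y - x' * y') \<le> B * (q2_norm (x - x') + q2_norm (y - y'))"
proof -
  have "x * y - x' * y' = x * (y - y') + (x - x') * y'" by (simp add: algebra_simps)
  then have "q2_norm (x * y - x' * y') \<le> q2_norm (x * (y - y')) + q2_norm ((x - x') * y')"
    using q2_norm_add by simp
  also have "\<dots> \<le> q2_norm x * q2_norm (y - y') + q2_norm (x - x') * q2_norm y'"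
    by (intro add_mono q2_norm_mult)
  also have "\<dots> \<le> B * q2_norm (y - y') + q2_norm (x - x') * B"
    using assms by (intro add_mono mult_left_mono mult_right_mono q2_norm_ge_0)
  finally show ?thesis by (simp add: algebra_simps)
qed

lemma q2_norm_convergent:
  assumes "q2_Cauchy X" shows "convergent (\<lambda>n. q2_norm (X n))"
proof -
  have "Cauchy (\<lambda>n. q2_norm (X n))"
  proof (rule metric_CauchyI)
    fix e :: real assume "e > 0"
    then obtain N where "\<forall>m\<ge>N. \<forall>n\<ge>N. q2_norm (X m - X n) < e"
      using assms unfolding q2_Cauchy_def by blast
    then show "\<exists>M. \<forall>m\<ge>M. \<forall>n\<ge>M. dist (q2_norm (X m)) (q2_norm (X n)) < e"
      by (metis dist_real_def order_le_less_trans q2_norm_triangle_sub)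
  qed
  then show ?thesis by (simp add: Cauchy_convergent_iff)
qed

instantiation q2 :: "{zero, one, plus, minus, uminus, times, scaleR, scaleC, star}"
begin

lift_definition zero_q2 :: q2 is "\<lambda>_. 0" by (simp add: q2_rel_refl)

lift_definition one_q2 :: q2 is "\<lambda>_. 1" by (simp add: q2_rel_refl)

lift_definition plus_q2 :: "q2 \<Rightarrow> q2 \<Rightarrow> q2" is "\<lambda>X Y n. X n + Y n"
proof -
  fix X X' Y Y' assume a: "q2_rel X X'" "q2_rel Y Y'"
  have le: "q2_norm (x + y - (x' + y')) \<le> 1 * (q2_norm (x - x') + q2_norm (y - y'))" for x x' y y'
    using q2_norm_add [of "x - x'" "y - y'"] by (simp add: algebra_simps)
  have "(\<lambda>n. q2_norm (X n - X' n) + q2_norm (Y n - Y' n)) \<longlonglongrightarrow> 0"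
    using a tendsto_add [of _ "0::real" _ _ 0] by (auto simp: q2_rel_def)
  then have "(\<lambda>n. q2_norm (X n + Y n - (X' n + Y' n))) \<longlonglongrightarrow> 0"
    by (rule tendsto_0_le) (use q2_norm_ge_0 le in auto)
  then show "q2_rel (\<lambda>n. X n + Y n) (\<lambda>n. X' n + Y' n)"
    using a q2_Cauchy_lipschitz2 [OF _ _ zero_less_one le] by (auto simp: q2_rel_def)
qed

lift_definition uminus_q2 :: "q2 \<Rightarrow> q2" is "\<lambda>X n. - X n"
  by (rule q2_rel_lipschitz [where C = 1]) (auto simp: q2_norm_minus_commute)

definition minus_q2 :: "q2 \<Rightarrow> q2 \<Rightarrow> q2" where "minus_q2 x y = x + (- y)"

lift_definition times_q2 :: "q2 \<Rightarrow> q2 \<Rightarrow> q2" is "\<lambda>X Y n. X n * Y n"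
proof -
  fix X X' Y Y' assume a: "q2_rel X X'" "q2_rel Y Y'"
  have C: "q2_Cauchy (\<lambda>n. X n * Y n)" if X: "q2_Cauchy X" and Y: "q2_Cauchy Y" for X Y
  proof -
    obtain B where B: "B > 0" "\<And>n. q2_norm (X n) \<le> B" using q2_Cauchy_bounded [OF X] by blast
    obtain D where D: "D > 0" "\<And>n. q2_norm (Y n) \<le> D" using q2_Cauchy_bounded [OF Y] by blast
    show ?thesis
      by (rule q2_Cauchy_lipschitz2 [OF X Y, of "max B D"])
        (use B D in \<open>auto intro!: q2_norm_mult_diff simp: le_max_iff_disj\<close>)
  qed
  obtain B where B: "B > 0" "\<And>n. q2_norm (X n) \<le> B"
    using q2_Cauchy_bounded [of X] a by (auto simp: q2_rel_def)
  obtain D where D: "D > 0" "\<And>n. q2_norm (Y' n) \<le> D"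
    using q2_Cauchy_bounded [of Y'] a by (auto simp: q2_rel_def)
  have "(\<lambda>n. max B D * (q2_norm (X n - X' n) + q2_norm (Y n - Y' n))) \<longlonglongrightarrow> 0"
    using a tendsto_add [of _ "0::real" _ _ 0] by (auto simp: q2_rel_def intro!: tendsto_mult_right_zero)
  then have "(\<lambda>n. q2_norm (X n * Y n - X' n * Y' n)) \<longlonglongrightarrow> 0"
    by (rule tendsto_0_le)
      (use B D in \<open>auto intro!: q2_norm_mult_diff simp: q2_norm_ge_0 le_max_iff_disj\<close>)
  then show "q2_rel (\<lambda>n. X n * Y n) (\<lambda>n. X' n * Y' n)"
    using a C by (auto simp: q2_rel_def)
qed

lift_definition scaleC_q2 :: "complex \<Rightarrow> q2 \<Rightarrow> q2" is "\<lambda>c X n. fconst c * X n"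
proof -
  fix c X X' assume a: "q2_rel X X'"
  show "q2_rel (\<lambda>n. fconst c * X n) (\<lambda>n. fconst c * X' n)"
  proof (rule q2_rel_lipschitz [OF a, of "cmod c + 1"])
    fix x y
    show "q2_norm (fconst c * x - fconst c * y) \<le> (cmod c + 1) * q2_norm (x - y)"
      using q2_norm_fconst [of c "x - y"] q2_norm_ge_0 [of "x - y"] by (simp add: algebra_simps)
  qed (simp add: add_nonneg_pos)
qed

definition scaleR_q2 :: "real \<Rightarrow> q2 \<Rightarrow> q2" where "scaleR_q2 r x = complex_of_real r *\<^sub>C x"

lift_definition star_q2 :: "q2 \<Rightarrow> q2" is "\<lambda>X n. fstar (X n)"
  by (rule q2_rel_lipschitz [where C = 1]) (auto simp: fstar_diff [symmetric] q2_norm_fstar)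

instance ..

end

lemma q2_Cauchy_abs: "q2_rel X X \<longleftrightarrow> q2_Cauchy X"
  by (auto simp: q2_rel_def)

lemma q2_cases:
  obtains X where "q2_Cauchy X" "x = abs_q2 X"
  by (metis Quotient3_abs_rep Quotient3_q2 Quotient3_rep_reflp q2_Cauchy_abs)

lemma abs_q2_eq_iff: "q2_Cauchy X \<Longrightarrow> q2_Cauchy Y \<Longrightarrow>
    abs_q2 X = abs_q2 Y \<longleftrightarrow> (\<lambda>n. q2_norm (X n - Y n)) \<longlonglongrightarrow> 0"
  using Quotient3_rel [OF Quotient3_q2, of X Y] by (auto simp: q2_rel_def)

lemmas q2_abs_eq = plus_q2.abs_eq times_q2.abs_eq uminus_q2.abs_eq scaleC_q2.abs_eq
  star_q2.abs_eq

lemma q2_Cauchy_ops: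
  assumes "q2_Cauchy X"
  shows "q2_Cauchy Y \<Longrightarrow> q2_Cauchy (\<lambda>n. X n + Y n)"
    and "q2_Cauchy Y \<Longrightarrow> q2_Cauchy (\<lambda>n. X n * Y n)"
    and "q2_Cauchy (\<lambda>n. - X n)"
    and "q2_Cauchy (\<lambda>n. fconst c * X n)"
    and "q2_Cauchy (\<lambda>n. fstar (X n))"
proof -
  note X = q2_rel_refl [OF assms]
  show "q2_Cauchy (\<lambda>n. X n + Y n)" if "q2_Cauchy Y"
    using plus_q2.rsp [unfolded rel_fun_def, rule_format, OF X q2_rel_refl [OF that]]
    by (simp add: q2_Cauchy_abs)
  show "q2_Cauchy (\<lambda>n. X n * Y n)" if "q2_Cauchy Y"
    using times_q2.rsp [unfolded rel_fun_def, rule_format, OF X q2_rel_refl [OF that]]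
    by (simp add: q2_Cauchy_abs)
  show "q2_Cauchy (\<lambda>n. - X n)"
    using uminus_q2.rsp [unfolded rel_fun_def, rule_format, OF X] by (simp add: q2_Cauchy_abs)
  show "q2_Cauchy (\<lambda>n. fconst c * X n)"
    using scaleC_q2.rsp [unfolded rel_fun_def, rule_format, OF refl X]
    by (simp add: q2_Cauchy_abs)
  show "q2_Cauchy (\<lambda>n. fstar (X n))"
    using star_q2.rsp [unfolded rel_fun_def, rule_format, OF X] by (simp add: q2_Cauchy_abs)
qed

definition of_free :: "free \<Rightarrow> q2" where
  "of_free x = abs_q2 (\<lambda>_. x)"

lemma of_free_hom:
  "of_free 1 = 1" "of_free 0 = 0"
  "of_free (x + y) = of_free x + of_free y"
  "of_free (x * y) = of_free x * of_free y"
  "of_free (- x) = - of_free x"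
  "of_free (x - y) = of_free x - of_free y"
  "of_free (fconst c * x) = c *\<^sub>C of_free x"
  "of_free (fstar x) = star (of_free x)"
  by (simp_all add: of_free_def one_q2_def zero_q2_def q2_abs_eq q2_Cauchy_abs q2_rel_refl
      minus_q2_def)

instantiation q2 :: real_normed_vector
begin

lift_definition norm_q2 :: "q2 \<Rightarrow> real" is "\<lambda>X. lim (\<lambda>n. q2_norm (X n))"
proof -
  fix X X' assume a: "q2_rel X X'"
  then obtain L where L: "(\<lambda>n. q2_norm (X n)) \<longlonglongrightarrow> L"
    using q2_norm_convergent by (auto simp: q2_rel_def convergent_def)
  have "(\<lambda>n. \<bar>q2_norm (X n) - q2_norm (X' n)\<bar>) \<longlonglongrightarrow> 0"
    by (rule tendsto_0_le [of "\<lambda>n. q2_norm (X n - X' n)"])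
      (use a q2_norm_triangle_sub in \<open>auto simp: q2_rel_def\<close>)
  then have "(\<lambda>n. q2_norm (X n) - q2_norm (X' n)) \<longlonglongrightarrow> 0"
    by (simp add: tendsto_rabs_zero_iff)
  then have "(\<lambda>n. q2_norm (X' n)) \<longlonglongrightarrow> L"
    using tendsto_diff [OF L] by fastforce
  then show "lim (\<lambda>n. q2_norm (X n)) = lim (\<lambda>n. q2_norm (X' n))"
    using L by (simp add: limI)
qed

definition sgn_q2 :: "q2 \<Rightarrow> q2" where "sgn_q2 x = x /\<^sub>R norm x"

definition dist_q2 :: "q2 \<Rightarrow> q2 \<Rightarrow> real" where "dist_q2 x y = norm (x - y)"

definition uniformity_q2 :: "(q2 \<times> q2) filter" where
  "uniformity_q2 = (INF e\<in>{0 <..}. principal {(x, y). dist x y < e})"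

definition open_q2 :: "q2 set \<Rightarrow> bool" where
  "open_q2 T \<longleftrightarrow> (\<forall>x\<in>T. \<forall>\<^sub>F (x', y) in uniformity. x' = x \<longrightarrow> y \<in> T)"

lemma norm_abs_q2: "q2_Cauchy X \<Longrightarrow> (\<lambda>n. q2_norm (X n)) \<longlonglongrightarrow> norm (abs_q2 X)"
  using q2_norm_convergent [of X]
  by (simp add: norm_q2.abs_eq q2_Cauchy_abs convergent_LIMSEQ_iff)

instance
proof
  fix x y z :: q2 and a b :: real
  obtain X where X: "q2_Cauchy X" "x = abs_q2 X" by (rule q2_cases)
  obtain Y where Y: "q2_Cauchy Y" "y = abs_q2 Y" by (rule q2_cases)
  obtain Z where Z: "q2_Cauchy Z" "z = abs_q2 Z" by (rule q2_cases)
  note C = X(1) Y(1) Z(1) q2_Cauchy_ops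
  note R = X(2) Y(2) Z(2) q2_abs_eq q2_Cauchy_abs C
  show "x + y + z = x + (y + z)" by (simp add: R add.assoc)
  show "x + y = y + x" by (simp add: R add.commute)
  show "0 + x = x" by (simp add: R zero_q2_def)
  show "- x + x = 0" by (simp add: R zero_q2_def)
  show "x - y = x + (- y)" by (simp add: minus_q2_def)
  show "a *\<^sub>R (x + y) = a *\<^sub>R x + a *\<^sub>R y"
    by (simp add: R scaleR_q2_def distrib_left)
  show "(a + b) *\<^sub>R x = a *\<^sub>R x + b *\<^sub>R x"
    by (simp add: R scaleR_q2_def fconst_add distrib_right)
  show "a *\<^sub>R b *\<^sub>R x = (a * b) *\<^sub>R x"
    by (simp add: R scaleR_q2_def fconst_mult mult.assoc)
  show "1 *\<^sub>R x = x" by (simp add: R scaleR_q2_def)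
  show "sgn x = x /\<^sub>R norm x" by (rule sgn_q2_def)
  show "dist x y = norm (x - y)" by (rule dist_q2_def)
  show "uniformity = (INF e\<in>{0 <..}. principal {(x, y :: q2). dist x y < e})"
    by (rule uniformity_q2_def)
  show "open T \<longleftrightarrow> (\<forall>x\<in>T. \<forall>\<^sub>F (x', y) in uniformity. x' = x \<longrightarrow> y \<in> T)" for T :: "q2 set"
    by (rule open_q2_def)
  show "norm x = 0 \<longleftrightarrow> x = 0"
  proof -
    have "x = 0 \<longleftrightarrow> (\<lambda>n. q2_norm (X n)) \<longlonglongrightarrow> 0"
      using abs_q2_eq_iff [of X "\<lambda>_. 0"] X by (simp add: zero_q2_def)
    then show ?thesis using norm_abs_q2 [OF X(1)] X(2) LIMSEQ_unique by metis
  qed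
  show "norm (x + y) \<le> norm x + norm y"
  proof (rule LIMSEQ_le)
    show "(\<lambda>n. q2_norm (X n + Y n)) \<longlonglongrightarrow> norm (x + y)"
      using norm_abs_q2 [of "\<lambda>n. X n + Y n"] by (simp add: R)
    show "(\<lambda>n. q2_norm (X n) + q2_norm (Y n)) \<longlonglongrightarrow> norm x + norm y"
      using norm_abs_q2 X Y by (auto intro: tendsto_add)
  qed (use q2_norm_add in auto)
  have "(\<lambda>n. \<bar>a\<bar> * q2_norm (X n)) \<longlonglongrightarrow> norm (a *\<^sub>R x)"
    using norm_abs_q2 [of "\<lambda>n. fconst (complex_of_real a) * X n"]
    by (simp add: R scaleR_q2_def q2_norm_fconst)
  moreover have "(\<lambda>n. \<bar>a\<bar> * q2_norm (X n)) \<longlonglongrightarrow> \<bar>a\<bar> * norm x"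
    using norm_abs_q2 X by (auto intro: tendsto_mult_left)
  ultimately show "norm (a *\<^sub>R x) = \<bar>a\<bar> * norm x" by (rule LIMSEQ_unique)
qed

end

lemma norm_of_free: "norm (of_free x) = q2_norm x"
  unfolding of_free_def
  by (rule LIMSEQ_unique [OF norm_abs_q2 [OF q2_Cauchy_const] tendsto_const])

lemma of_free_tendsto:
  assumes "q2_Cauchy X" shows "(\<lambda>n. of_free (X n)) \<longlonglongrightarrow> abs_q2 X"
proof (rule metric_LIMSEQ_I)
  fix e :: real assume "e > 0"
  then have "e / 2 > 0" by simp
  then obtain N where N: "\<forall>m\<ge>N. \<forall>n\<ge>N. q2_norm (X m - X n) < e / 2"
    using assms unfolding q2_Cauchy_def by blast
  have "dist (of_free (X n)) (abs_q2 X) < e" if n: "n \<ge> N" for n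
  proof -
    have C: "q2_Cauchy (\<lambda>m. X n + (- X m))"
      by (intro q2_Cauchy_ops assms q2_Cauchy_const)
    have "of_free (X n) - abs_q2 X = abs_q2 (\<lambda>m. X n + (- X m))"
      using assms by (simp add: minus_q2_def of_free_def q2_abs_eq q2_Cauchy_abs q2_Cauchy_ops)
    then have "(\<lambda>m. q2_norm (X n - X m)) \<longlonglongrightarrow> dist (of_free (X n)) (abs_q2 X)"
      using norm_abs_q2 [OF C] by (simp add: dist_norm)
    moreover have "\<forall>m\<ge>N. q2_norm (X n - X m) \<le> e / 2"
      using N n less_imp_le by blast
    ultimately have "dist (of_free (X n)) (abs_q2 X) \<le> e / 2"
      using LIMSEQ_le_const2 by blast
    then show ?thesis using \<open>e > 0\<close> by linarith
  qed
  then show "\<exists>N. \<forall>n\<ge>N. dist (of_free (X n)) (abs_q2 X) < e" by blast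
qed

lemma of_free_dense:
  assumes "e > 0" shows "\<exists>x. dist (of_free x) z < e"
proof -
  obtain Z where Z: "q2_Cauchy Z" "z = abs_q2 Z" by (rule q2_cases)
  obtain N where "\<forall>n\<ge>N. dist (of_free (Z n)) z < e"
    using metric_LIMSEQ_D [OF of_free_tendsto [OF Z(1)] assms] Z(2) by auto
  then show ?thesis by auto
qed

instance q2 :: banach
proof
  fix Z :: "nat \<Rightarrow> q2" assume Z: "Cauchy Z"
  have "\<forall>n. \<exists>x. dist (of_free x) (Z n) < inverse (real (Suc n))"
    by (intro allI of_free_dense) simp
  then obtain X where X: "\<And>n. dist (of_free (X n)) (Z n) < inverse (real (Suc n))"
    by metis
  have 0: "(\<lambda>n. dist (of_free (X n)) (Z n)) \<longlonglongrightarrow> 0"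
    by (rule tendsto_0_le [OF LIMSEQ_inverse_real_of_nat], simp, rule less_imp_le, rule X)
  have "q2_Cauchy X"
    unfolding q2_Cauchy_def
  proof (intro allI impI)
    fix e :: real assume "e > 0"
    then have e: "e / 3 > 0" by simp
    obtain N where N: "\<forall>m\<ge>N. \<forall>n\<ge>N. dist (Z m) (Z n) < e / 3"
      using metric_CauchyD [OF Z e] by blast
    obtain M where M: "\<forall>n\<ge>M. dist (of_free (X n)) (Z n) < e / 3"
      using metric_LIMSEQ_D [OF 0 e] by auto
    have "q2_norm (X m - X n) < e" if "m \<ge> max M N" "n \<ge> max M N" for m n
    proof -
      have "q2_norm (X m - X n) = dist (of_free (X m)) (of_free (X n))"
        by (simp only: dist_norm of_free_hom(6) [symmetric] norm_of_free)
      also have "\<dots> \<le> dist (of_free (X m)) (Z m) + dist (Z m) (Z n) + dist (of_free (X n)) (Z n)"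
        using dist_triangle [of "of_free (X m)" "of_free (X n)" "Z m"]
          dist_triangle [of "Z m" "of_free (X n)" "Z n"] by (simp add: dist_commute)
      also have "\<dots> < e / 3 + e / 3 + e / 3"
        by (intro add_strict_mono) (use M N that in auto)
      finally show ?thesis by simp
    qed
    then show "\<exists>N. \<forall>m\<ge>N. \<forall>n\<ge>N. q2_norm (X m - X n) < e" by blast
  qed
  then have "(\<lambda>n. of_free (X n)) \<longlonglongrightarrow> abs_q2 X" by (rule of_free_tendsto)
  then have "(\<lambda>n. dist (of_free (X n)) (abs_q2 X)) \<longlonglongrightarrow> 0"
    by (rule iffD1 [OF tendsto_dist_iff])
  from tendsto_add [OF 0 this]
  have "(\<lambda>n. dist (of_free (X n)) (Z n) + dist (of_free (X n)) (abs_q2 X)) \<longlonglongrightarrow> 0"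
    by (simp only: add_0)
  then have "(\<lambda>n. dist (Z n) (abs_q2 X)) \<longlonglongrightarrow> 0"
    by (rule tendsto_0_le) (rule zero_le_dist, rule dist_triangle3)
  then have "Z \<longlonglongrightarrow> abs_q2 X" by (rule iffD2 [OF tendsto_dist_iff])
  then show "convergent Z" by (auto simp: convergent_def)
qed

instance q2 :: unital_cstar_algebra
proof
  fix x y z :: q2 and a b :: complex and r :: real
  obtain X where X: "q2_Cauchy X" "x = abs_q2 X" by (rule q2_cases)
  obtain Y where Y: "q2_Cauchy Y" "y = abs_q2 Y" by (rule q2_cases)
  obtain Z where Z: "q2_Cauchy Z" "z = abs_q2 Z" by (rule q2_cases)
  note C = X(1) Y(1) Z(1) q2_Cauchy_ops
  note R = X(2) Y(2) Z(2) q2_abs_eq q2_Cauchy_abs C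
  have comm: "u * (fconst c * v) = fconst c * (u * v)" for u v c
    by (metis fconst_comm mult.assoc)
  show "x * y * z = x * (y * z)" by (simp add: R mult.assoc)
  show "(x + y) * z = x * z + y * z" by (simp add: R distrib_right)
  show "x * (y + z) = x * y + x * z" by (simp add: R distrib_left)
  show "1 * x = x" "x * 1 = x" by (simp_all add: R one_q2_def)
  show "r *\<^sub>R x * y = r *\<^sub>R (x * y)" by (simp add: R scaleR_q2_def mult.assoc)
  show "x * r *\<^sub>R y = r *\<^sub>R (x * y)" by (simp add: R scaleR_q2_def comm)
  show "a *\<^sub>C (x + y) = a *\<^sub>C x + a *\<^sub>C y" by (simp add: R distrib_left)
  show "(a + b) *\<^sub>C x = a *\<^sub>C x + b *\<^sub>C x" by (simp add: R fconst_add distrib_right)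
  show "a *\<^sub>C b *\<^sub>C x = (a * b) *\<^sub>C x" by (simp add: R fconst_mult mult.assoc)
  show "r *\<^sub>R x = complex_of_real r *\<^sub>C x" by (rule scaleR_q2_def)
  show "a *\<^sub>C x * y = a *\<^sub>C (x * y)" by (simp add: R mult.assoc)
  show "x * a *\<^sub>C y = a *\<^sub>C (x * y)" by (simp add: R comm)
  show "star (x + y) = star x + star y" by (simp add: R fstar_add)
  show "star (a *\<^sub>C x) = cnj a *\<^sub>C star x" by (simp add: R fstar_fconst_mult)
  show "star (x * y) = star y * star x" by (simp add: R fstar_mult)
  show "star (star x) = x" by (simp add: R)
  show "norm (x * y) \<le> norm x * norm y"
  proof (rule LIMSEQ_le)
    show "(\<lambda>n. q2_norm (X n * Y n)) \<longlonglongrightarrow> norm (x * y)"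
      using norm_abs_q2 [of "\<lambda>n. X n * Y n"] by (simp add: R)
    show "(\<lambda>n. q2_norm (X n) * q2_norm (Y n)) \<longlonglongrightarrow> norm x * norm y"
      using norm_abs_q2 X Y by (auto intro: tendsto_mult)
  qed (use q2_norm_mult in auto)
  have "(\<lambda>n. cmod a * q2_norm (X n)) \<longlonglongrightarrow> norm (a *\<^sub>C x)"
    using norm_abs_q2 [of "\<lambda>n. fconst a * X n"] by (simp add: R q2_norm_fconst)
  moreover have "(\<lambda>n. cmod a * q2_norm (X n)) \<longlonglongrightarrow> cmod a * norm x"
    using norm_abs_q2 X by (auto intro: tendsto_mult_left)
  ultimately show "norm (a *\<^sub>C x) = cmod a * norm x" by (rule LIMSEQ_unique)
  have "(\<lambda>n. (q2_norm (X n))\<^sup>2) \<longlonglongrightarrow> norm (star x * x)"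
    using norm_abs_q2 [of "\<lambda>n. fstar (X n) * X n"] by (simp add: R q2_norm_cstar)
  moreover have "(\<lambda>n. (q2_norm (X n))\<^sup>2) \<longlonglongrightarrow> (norm x)\<^sup>2"
    using norm_abs_q2 X by (auto intro: tendsto_power)
  ultimately show "norm (star x * x) = (norm x)\<^sup>2" by (rule LIMSEQ_unique)
qed

definition Q2_U :: q2 where "Q2_U = of_free (fgen Gen_U)"
definition Q2_S2 :: q2 where "Q2_S2 = of_free (fgen Gen_S)"
definition Q2_S1 :: q2 where "Q2_S1 = Q2_U * Q2_S2"

definition q2_relations :: "'a::unital_cstar_algebra \<Rightarrow> 'a \<Rightarrow> bool" where
  "q2_relations u s \<longleftrightarrow> unitary u \<and> isometry s \<and> s * u = u\<^sup>2 * s \<and>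
     s * star s + u * s * star s * star u = 1"

lemma q2_relations_Q2: "q2_relations Q2_U Q2_S2"
proof -
  have 0: "of_free r = 0" if "r \<in> q2_relators" for r
    using q2_norm_relators [OF that] norm_of_free [of r] by simp
  have eq: "of_free a = of_free b" if "a - b \<in> q2_relators" for a b
    using 0 [OF that] by (simp add: of_free_hom)
  let ?U = "fgen Gen_U" and ?S = "fgen Gen_S"
  have "of_free (fstar ?U * ?U) = of_free 1" "of_free (?U * fstar ?U) = of_free 1"
    "of_free (fstar ?S * ?S) = of_free 1" "of_free (?S * ?U) = of_free (?U\<^sup>2 * ?S)"
    "of_free (?S * fstar ?S + ?U * ?S * fstar ?S * fstar ?U) = of_free 1"
    by (rule eq, simp add: q2_relators_def Let_def)+
  then show ?thesis
    by (simp add: q2_relations_def unitary_def isometry_def Q2_U_def Q2_S2_def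
        power2_eq_square of_free_hom)
qed

subsection \<open>Universal property\<close>

lemma star_subalgebra_cstar_generated:
  "star_subalgebra (cstar_generated X)" "closed (cstar_generated X)" "X \<subseteq> cstar_generated X"
  by (auto simp: cstar_generated_def star_subalgebra_def)

lemma Q2_generated: "cstar_generated {Q2_U, Q2_S2} = UNIV"
proof -
  let ?A = "cstar_generated {Q2_U, Q2_S2}"
  note A = star_subalgebra_cstar_generated [of "{Q2_U, Q2_S2}"]
  have gen: "of_free (fgen g) \<in> ?A" for g
    using A(3) by (cases g) (auto simp: Q2_U_def Q2_S2_def)
  have letter: "of_free (Poly_Mapping.single (Word [a]) 1) \<in> ?A" for a
  proof -
    obtain g b where a: "a = (g, b)" by force
    have "Poly_Mapping.single (Word [a]) 1 = (if b then fstar (fgen g) else fgen g)"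
      by (auto simp: a fgen_def wstar_def)
    then show ?thesis using gen A(1) by (auto simp: of_free_hom star_subalgebra_def)
  qed
  have word: "of_free (Poly_Mapping.single (Word l) 1) \<in> ?A" for l
  proof (induction l)
    case Nil
    then show ?case using A(1)
      by (simp add: zero_word_def [symmetric] of_free_hom star_subalgebra_def)
  next
    case (Cons a l)
    have "Poly_Mapping.single (Word (a # l)) (1::complex)
        = Poly_Mapping.single (Word [a]) 1 * Poly_Mapping.single (Word l) 1"
      by (simp add: mult_single plus_word_def)
    then show ?case using Cons letter A(1) by (simp add: of_free_hom star_subalgebra_def)
  qed
  have free: "of_free x \<in> ?A" for x
  proof (induction x rule: free_induct)
    case (single w c)
    have "Poly_Mapping.single w c = fconst c * Poly_Mapping.single w 1"
      by (simp add: fconst_def mult_single)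
    then have "of_free (Poly_Mapping.single w c) = c *\<^sub>C of_free (Poly_Mapping.single w 1)"
      by (simp only: of_free_hom(7))
    then show ?case using word [of "letters w"] A(1) by (simp add: star_subalgebra_def)
  next
    case (add f g)
    then show ?case using A(1) by (simp add: of_free_hom star_subalgebra_def)
  qed
  have "x \<in> ?A" for x
  proof -
    obtain X where X: "q2_Cauchy X" "x = abs_q2 X" by (rule q2_cases)
    show ?thesis
      using closed_sequentially [OF A(2) free of_free_tendsto [OF X(1)]] X(2) by simp
  qed
  then show ?thesis by blast
qed

lemma scaleC_zero_left: "0 *\<^sub>C (x :: 'a::unital_cstar_algebra) = 0"
  using scaleC_add_left [of 0 0 x] by simp

lemma scaleC_zero_right: "c *\<^sub>C (0 :: 'a::unital_cstar_algebra) = 0"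
  using scaleC_add_right [of c 0 "0 :: 'a"] by simp

lemma scaleC_one: "1 *\<^sub>C (x :: 'a::unital_cstar_algebra) = x"
  using scaleR_scaleC [of 1 x] by simp

lemma star_one: "star (1 :: 'a::unital_cstar_algebra) = 1"
  by (metis star_mult star_star mult_1_left mult_1_right)

lemma star_minus: "star (x - y :: 'a::unital_cstar_algebra) = star x - star y"
  using star_add [of "x - y" y] by simp

lemma norm_star: "norm (star x :: 'a::unital_cstar_algebra) = norm x"
proof -
  have le: "norm x \<le> norm (star x)" for x :: 'a
  proof (cases "x = 0")
    case False
    have "norm x * norm x \<le> norm (star x) * norm x"
      using norm_mult_ineq [of "star x" x] by (simp add: cstar_identity power2_eq_square)
    then show ?thesis using False by simp
  qed simp
  show ?thesis using le [of x] le [of "star x"] by (simp add: star_star)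
qed

definition word_eval :: "'a::unital_cstar_algebra \<Rightarrow> 'a \<Rightarrow> word \<Rightarrow> 'a" where
  "word_eval u s w = foldr (\<lambda>(g, b) x.
     (let y = (case g of Gen_U \<Rightarrow> u | Gen_S \<Rightarrow> s) in if b then star y else y) * x) (letters w) 1"

definition free_eval :: "'a::unital_cstar_algebra \<Rightarrow> 'a \<Rightarrow> free \<Rightarrow> 'a" where
  "free_eval u s f = (\<Sum>w\<in>Poly_Mapping.keys f. Poly_Mapping.lookup f w *\<^sub>C word_eval u s w)"

lemma word_eval_0: "word_eval u s 0 = 1"
  by (simp add: word_eval_def zero_word_def)

lemma word_eval_add: "word_eval u s (v + w) = word_eval u s v * word_eval u s w"
proof -
  have "word_eval u s (Word l + w) = word_eval u s (Word l) * word_eval u s w" for l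
    by (induction l) (auto simp: word_eval_def plus_word_def mult.assoc)
  from this [of "letters v"] show ?thesis by simp
qed

lemma word_eval_wstar: "word_eval u s (wstar w) = star (word_eval u s w)"
proof -
  have "word_eval u s (wstar (Word l)) = star (word_eval u s (Word l))" for l
  proof (induction l)
    case (Cons a l)
    obtain g b where a: "a = (g, b)" by force
    have 1: "word_eval u s (wstar (Word [a])) = star (word_eval u s (Word [a]))"
      by (cases g) (auto simp: a word_eval_def wstar_def star_star)
    have "Word (a # l) = Word [a] + Word l" by (simp add: plus_word_def)
    then show ?case using Cons 1 by (simp only: wstar_add word_eval_add star_mult)
  qed (simp add: word_eval_def wstar_def star_one)
  from this [of "letters w"] show ?thesis by simp
qed

lemma free_eval_single: "free_eval u s (Poly_Mapping.single w c) = c *\<^sub>C word_eval u s w"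
  by (simp add: free_eval_def scaleC_zero_left)

lemma free_eval_superset:
  "finite A \<Longrightarrow> Poly_Mapping.keys f \<subseteq> A \<Longrightarrow>
    free_eval u s f = (\<Sum>w\<in>A. Poly_Mapping.lookup f w *\<^sub>C word_eval u s w)"
  unfolding free_eval_def
  by (rule sum.mono_neutral_left) (auto simp: in_keys_iff scaleC_zero_left)

lemma free_eval_add: "free_eval u s (f + g) = free_eval u s f + free_eval u s g"
proof -
  let ?A = "Poly_Mapping.keys f \<union> Poly_Mapping.keys g"
  have "free_eval u s (f + g) = (\<Sum>w\<in>?A. Poly_Mapping.lookup (f + g) w *\<^sub>C word_eval u s w)"
    by (rule free_eval_superset) (auto simp: Poly_Mapping.keys_add)
  also have "\<dots> = free_eval u s f + free_eval u s g"
    by (simp add: free_eval_superset [of ?A] lookup_add scaleC_add_left sum.distrib)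
  finally show ?thesis .
qed

lemma free_eval_mult: "free_eval u s (f * g) = free_eval u s f * free_eval u s g"
proof (induction f rule: free_induct)
  case (single w c)
  show ?case
    by (induction g rule: free_induct)
      (simp_all add: free_eval_add free_eval_single mult_single word_eval_add distrib_left
        mult_scaleC_left mult_scaleC_right scaleC_scaleC mult.commute)
qed (simp add: free_eval_add distrib_right)

lemma free_eval_star: "free_eval u s (fstar f) = star (free_eval u s f)"
  by (induction f rule: free_induct)
    (simp_all add: free_eval_single free_eval_add fstar_add star_add star_scaleC word_eval_wstar)

lemma free_eval_fconst: "free_eval u s (fconst c * f) = c *\<^sub>C free_eval u s f"
  by (simp add: free_eval_mult) (simp add: fconst_def free_eval_single word_eval_0 mult_scaleC_left)

lemma free_eval_1: "free_eval u s 1 = 1"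
  using free_eval_single [of u s 0 1] by (simp add: word_eval_0 scaleC_one)

lemma free_eval_diff: "free_eval u s (f - g) = free_eval u s f - free_eval u s g"
  using free_eval_add [of u s "f - g" g] by (simp add: algebra_simps)

lemma free_eval_gen:
  "free_eval u s (fgen Gen_U) = u" "free_eval u s (fgen Gen_S) = s"
  by (simp_all add: fgen_def free_eval_single word_eval_def scaleC_one)

lemma free_eval_le:
  assumes "q2_relations u s" shows "norm (free_eval u s f) \<le> q2_norm f"
proof (rule q2_norm_upper)
  show "q2_seminorm (\<lambda>f. norm (free_eval u s f))"
    unfolding q2_seminorm_def
  proof (intro conjI allI ballI)
    fix r assume "r \<in> q2_relators"
    then have "free_eval u s r = 0"
      using assms by (auto simp: q2_relators_def Let_def q2_relations_def unitary_def isometry_def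
          power2_eq_square free_eval_diff free_eval_add free_eval_mult free_eval_star free_eval_1
          free_eval_gen)
    then show "norm (free_eval u s r) = 0" by simp
  next
    show "norm (free_eval u s (fconst c * f)) = cmod c * norm (free_eval u s f)" for c f
      by (simp only: free_eval_fconst norm_scaleC)
  qed (simp_all add: free_eval_add free_eval_mult free_eval_star
      cstar_identity norm_triangle_ineq norm_mult_ineq)
qed

text \<open>Together with \<open>Q2_generated\<close> and \<open>q2_relations_Q2\<close> this is the universal property of
  the 2-adic ring C*-algebra among all unital C*-algebras.\<close>

theorem Q2_universal:
  fixes u s :: "'a::unital_cstar_algebra"
  assumes "q2_relations u s"
  shows "\<exists>f. star_hom_on UNIV f \<and> f Q2_U = u \<and> f Q2_S2 = s"
proof -
  let ?e = "free_eval u s"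
  define f where "f x = (THE l. \<exists>X. q2_Cauchy X \<and> x = abs_q2 X \<and> (\<lambda>n. ?e (X n)) \<longlonglongrightarrow> l)" for x
  have lim: "(\<lambda>n. ?e (X n)) \<longlonglongrightarrow> f (abs_q2 X)" if X: "q2_Cauchy X" for X
  proof -
    have "Cauchy (\<lambda>n. ?e (X n))"
    proof (rule metric_CauchyI)
      fix e :: real assume "e > 0"
      then obtain N where N: "\<forall>m\<ge>N. \<forall>n\<ge>N. q2_norm (X m - X n) < e"
        using X unfolding q2_Cauchy_def by blast
      have "dist (?e (X m)) (?e (X n)) \<le> q2_norm (X m - X n)" for m n
        unfolding dist_norm free_eval_diff [symmetric] by (rule free_eval_le [OF assms])
      then show "\<exists>M. \<forall>m\<ge>M. \<forall>n\<ge>M. dist (?e (X m)) (?e (X n)) < e"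
        using N order_le_less_trans by blast
    qed
    then obtain l where l: "(\<lambda>n. ?e (X n)) \<longlonglongrightarrow> l"
      using Cauchy_convergent convergent_def by blast
    have "f (abs_q2 X) = l"
      unfolding f_def
    proof (rule the_equality)
      show "\<exists>Y. q2_Cauchy Y \<and> abs_q2 X = abs_q2 Y \<and> (\<lambda>n. ?e (Y n)) \<longlonglongrightarrow> l"
        using X l by blast
      fix l' assume "\<exists>Y. q2_Cauchy Y \<and> abs_q2 X = abs_q2 Y \<and> (\<lambda>n. ?e (Y n)) \<longlonglongrightarrow> l'"
      then obtain Y where Y: "q2_Cauchy Y" "abs_q2 X = abs_q2 Y" "(\<lambda>n. ?e (Y n)) \<longlonglongrightarrow> l'"
        by blast
      have 0: "(\<lambda>n. q2_norm (X n - Y n)) \<longlonglongrightarrow> 0"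
        using abs_q2_eq_iff [OF X Y(1)] Y(2) by simp
      have "(\<lambda>n. norm (?e (X n) - ?e (Y n))) \<longlonglongrightarrow> 0"
      proof (rule tendsto_0_le [OF 0])
        show "norm (?e (X n) - ?e (Y n)) \<le> q2_norm (X n - Y n)" for n
          unfolding free_eval_diff [symmetric] by (rule free_eval_le [OF assms])
      qed simp
      then have "(\<lambda>n. ?e (X n) - ?e (Y n)) \<longlonglongrightarrow> 0" by (rule tendsto_norm_zero_cancel)
      moreover have "(\<lambda>n. ?e (X n) - ?e (Y n)) \<longlonglongrightarrow> l - l'" by (rule tendsto_diff [OF l Y(3)])
      ultimately have "l - l' = 0" using LIMSEQ_unique by blast
      then show "l' = l" by simp
    qed
    then show ?thesis using l by simp
  qed
  have free: "f (of_free x) = ?e x" for x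
    using LIMSEQ_unique [OF lim [OF q2_Cauchy_const] tendsto_const] by (simp add: of_free_def)
  have hom: "f (x + y) = f x + f y \<and> f (x * y) = f x * f y \<and> f (star x) = star (f x)
      \<and> f (c *\<^sub>C x) = c *\<^sub>C f x" for x y c
  proof -
    obtain X where X: "q2_Cauchy X" "x = abs_q2 X" by (rule q2_cases)
    obtain Y where Y: "q2_Cauchy Y" "y = abs_q2 Y" by (rule q2_cases)
    note C = q2_Cauchy_ops [OF X(1)]
    note E = X(2) Y(2) q2_abs_eq q2_Cauchy_abs X(1) Y(1)
    have fx: "(\<lambda>n. ?e (X n)) \<longlonglongrightarrow> f x" and fy: "(\<lambda>n. ?e (Y n)) \<longlonglongrightarrow> f y"
      using lim X Y by auto
    have "(\<lambda>n. ?e (X n) + ?e (Y n)) \<longlonglongrightarrow> f (x + y)"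
      using lim [OF C(1) [OF Y(1)]] by (simp add: E free_eval_add)
    then have 1: "f (x + y) = f x + f y" using tendsto_add [OF fx fy] by (rule LIMSEQ_unique)
    have "(\<lambda>n. ?e (X n) * ?e (Y n)) \<longlonglongrightarrow> f (x * y)"
      using lim [OF C(2) [OF Y(1)]] by (simp add: E free_eval_mult)
    then have 2: "f (x * y) = f x * f y" using tendsto_mult [OF fx fy] by (rule LIMSEQ_unique)
    have n0: "(\<lambda>n. norm (?e (X n) - f x)) \<longlonglongrightarrow> 0"
      using fx by (rule tendsto_norm_zero [OF LIM_zero])
    have "(\<lambda>n. norm (star (?e (X n)) - star (f x))) \<longlonglongrightarrow> 0"
      using n0 by (simp add: star_minus [symmetric] norm_star)
    then have "(\<lambda>n. star (?e (X n))) \<longlonglongrightarrow> star (f x)"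
      by (rule LIM_zero_cancel [OF tendsto_norm_zero_cancel])
    moreover have "(\<lambda>n. star (?e (X n))) \<longlonglongrightarrow> f (star x)"
      using lim [OF C(5)] by (simp add: E free_eval_star)
    ultimately have 3: "f (star x) = star (f x)" by (metis LIMSEQ_unique)
    have sc: "c *\<^sub>C z = (c *\<^sub>C 1) * z" for z :: 'a by (simp add: mult_scaleC_left)
    have "(\<lambda>n. c *\<^sub>C ?e (X n)) \<longlonglongrightarrow> f (c *\<^sub>C x)"
      using lim [OF C(4), of c] by (simp add: E free_eval_fconst)
    moreover have "(\<lambda>n. c *\<^sub>C ?e (X n)) \<longlonglongrightarrow> c *\<^sub>C f x"
      unfolding sc [of "?e _"] sc [of "f x"] by (rule tendsto_mult_left [OF fx])
    ultimately have 4: "f (c *\<^sub>C x) = c *\<^sub>C f x" by (rule LIMSEQ_unique)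
    show ?thesis using 1 2 3 4 by blast
  qed
  have "f 1 = 1" using free [of 1] by (simp add: of_free_hom free_eval_1)
  then have "star_hom_on UNIV f \<and> f Q2_U = u \<and> f Q2_S2 = s"
    using hom by (simp add: star_hom_on_def Q2_U_def Q2_S2_def free free_eval_gen)
  then show ?thesis by blast
qed

section \<open>The Cuntz algebra and the flip-flop\<close>

definition Cuntz_O2 :: "q2 set" where
  "Cuntz_O2 = cstar_generated {Q2_S1, Q2_S2}"

text \<open>Only the values on \<open>Cuntz_O2\<close> matter: for a map \<open>f\<close> on the whole algebra, \<open>flip_flop f\<close>
  says that \<open>f\<close> restricts to the flip-flop, i.e. extends it.\<close>

definition flip_flop :: "(q2 \<Rightarrow> q2) \<Rightarrow> bool" where
  "flip_flop f \<longleftrightarrow> star_automorphism_on Cuntz_O2 f \<and> f Q2_S1 = Q2_S2 \<and> f Q2_S2 = Q2_S1"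

end

theory Submission
  imports Defs
begin

text \<open>
  The relations defining the algebra are also satisfied by \<open>U\<^sup>*\<close> and \<open>US\<^sub>2\<close>, so the universal
  property yields an endomorphism \<open>L\<close>.  It is an involution, because \<open>L \<circ> L\<close> fixes both
  generators; hence it is bijective, and it exchanges \<open>S\<^sub>1\<close> and \<open>S\<^sub>2\<close>.  That two *-homomorphisms
  agreeing on generators are equal requires their continuity, which is automatic
  (\<open>star_hom_norm_le\<close>): a small self-adjoint element \<open>h\<close> is the real part of the unitary
  \<open>h + i sqrt (1 - h\<^sup>2)\<close>, and unitaries are mapped to unitaries, which have norm at most 1.

  Outerness is seen in the canonical representation on \<open>\<ell>\<^sup>2(\<int>)\<close>, where \<open>U e\<^sub>k = e\<^bsub>k+1\<^esub>\<close> and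
  \<open>S\<^sub>2 e\<^sub>k = e\<^bsub>2k\<^esub>\<close>.  Suppose that a unitary \<open>w\<close> of the algebra satisfies \<open>wU = U\<^sup>*w\<close> and
  \<open>wS\<^sub>2 = US\<^sub>2w\<close>.  Comparing matrix coefficients, the first relation makes \<open>\<langle>w e\<^sub>k, e\<^sub>j\<rangle>\<close> a function
  of \<open>j + k\<close> alone, and the second forces it to vanish unless \<open>j + k = -1\<close>.  So \<open>w\<close> acts as a
  multiple \<open>c\<close> of the reflection \<open>e\<^sub>k \<mapsto> e\<^bsub>-1-k\<^esub>\<close>.  But a word in \<open>U\<close>, \<open>S\<^sub>2\<close> and their adjoints
  moves the basis vectors by a strictly increasing partial map, whose graph meets the decreasing
  graph of the reflection at most once (\<open>finite_antidiagonal_coeff\<close>).  Hence a finite linear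
  combination of words has only finitely many nonzero coefficients on the antidiagonal
  \<open>j + k = -1\<close>.  Approximating \<open>w\<close> in norm by such combinations gives \<open>c = 0\<close>
  (\<open>intertwiner_mat_coeff_zero\<close>), so \<open>w\<close> acts as zero, and then so does \<open>w\<^sup>*w = 1\<close>,
  a contradiction.

  The Hilbert space itself is never completed.  The free *-algebra acts on finitely supported
  vectors, the operator norm of this action is a C*-seminorm that kills the relators
  (\<open>q2_seminorm_opnorm\<close>), and therefore each matrix coefficient is dominated by the universal
  seminorm and extends to the completion.
\<close>

section \<open>Automatic continuity\<close>

lemma bounded_linear_star: "bounded_linear (star :: 'a::unital_cstar_algebra \<Rightarrow> 'a)"
  by (rule bounded_linear_intro [where K = 1])
    (simp_all add: star_add scaleR_scaleC star_scaleC norm_star)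

lemma norm_unitary_le:
  assumes "unitary u" shows "norm u \<le> 1"
proof -
  have "norm (1::'a) = (norm (1::'a))\<^sup>2"
    using cstar_identity [of "1::'a"] by (simp add: star_one)
  then have "norm (1::'a) \<le> 1" by (auto simp: power2_eq_square)
  moreover have "(norm u)\<^sup>2 = norm (1::'a)"
    using assms cstar_identity [of u] by (simp add: unitary_def)
  ultimately show ?thesis by (simp add: power2_le_imp_le)
qed

text \<open>Writing \<open>y = 1 - z\<close> turns \<open>y\<^sup>2 = 1 - h\<^sup>2\<close> into the fixed point equation
  \<open>z = (h\<^sup>2 + z\<^sup>2) / 2\<close>, whose right-hand side is a contraction on the ball of radius \<open>1/2\<close>.
  Being self-adjoint and commuting with \<open>h\<close> are closed conditions preserved by the iteration, so
  the fixed point inherits them.\<close>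

lemma sqrt_one_minus_square_exists:
  fixes h :: "'a::unital_cstar_algebra"
  assumes h: "star h = h" "norm h \<le> 1/2"
  shows "\<exists>y. star y = y \<and> h * y = y * h \<and> y * y = 1 - h * h"
proof -
  define s where "s = {z. norm z \<le> 1/2 \<and> star z = z \<and> h * z = z * h}"
  define F where "F z = (1/2::real) *\<^sub>R (h * h + z * z)" for z
  have "closed s"
    unfolding s_def
    by (intro closed_Collect_conj closed_Collect_le closed_Collect_eq continuous_intros
        bounded_linear.continuous_on [OF bounded_linear_star])
  then have "complete s" by (simp add: complete_eq_closed)
  moreover have "s \<noteq> {}"
  proof -
    have "0 \<in> s" using star_minus [of h h] by (simp add: s_def)
    then show ?thesis by blast
  qed
  moreover have "F ` s \<subseteq> s"
  proof clarify
    fix z assume z: "z \<in> s"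
    have sq: "norm (x * x) \<le> 1/4" if "norm x \<le> 1/2" for x :: 'a
    proof -
      have "norm (x * x) \<le> norm x * norm x" by (rule norm_mult_ineq)
      also have "\<dots> \<le> 1/2 * (1/2)" using that by (intro mult_mono) auto
      finally show ?thesis by simp
    qed
    have "norm (h * h + z * z) \<le> 1/4 + 1/4"
      using sq [OF h(2)] sq [of z] z norm_triangle_ineq [of "h * h" "z * z"]
      by (simp add: s_def)
    moreover have "star (F z) = F z"
      using z h(1) by (simp add: F_def scaleR_scaleC star_scaleC star_add star_mult s_def)
    moreover have "h * F z = F z * h"
    proof -
      have "h * (z * z) = z * z * h" using z by (simp add: s_def mult.assoc) (metis mult.assoc)
      then show ?thesis by (simp add: F_def distrib_left distrib_right mult.assoc)
    qed
    ultimately show "F z \<in> s" by (simp add: s_def F_def)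
  qed
  moreover have "\<forall>z\<in>s. \<forall>w\<in>s. dist (F z) (F w) \<le> 1/2 * dist z w"
  proof (intro ballI)
    fix z w assume zw: "z \<in> s" "w \<in> s"
    have "F z - F w = (1/2::real) *\<^sub>R (z * (z - w) + (z - w) * w)"
      by (simp add: F_def algebra_simps)
    then have "norm (F z - F w) = 1/2 * norm (z * (z - w) + (z - w) * w)" by simp
    also have "\<dots> \<le> 1/2 * (norm z * norm (z - w) + norm (z - w) * norm w)"
      by (intro mult_left_mono norm_triangle_le add_mono norm_mult_ineq) auto
    also have "\<dots> \<le> 1/2 * (1/2 * norm (z - w) + norm (z - w) * (1/2))"
      using zw by (intro mult_left_mono add_mono mult_right_mono) (auto simp: s_def)
    finally show "dist (F z) (F w) \<le> 1/2 * dist z w" by (simp add: dist_norm)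
  qed
  ultimately have "\<exists>!z\<in>s. F z = z"
    by (intro Banach_fix [where c = "1/2"]) auto
  then obtain z where z: "z \<in> s" "F z = z" by blast
  have "2 *\<^sub>R z = h * h + z * z"
    using arg_cong [OF z(2), of "\<lambda>x. 2 *\<^sub>R x"] by (simp add: F_def)
  then have "(1 - z) * (1 - z) = 1 - h * h"
    by (simp add: algebra_simps scaleR_2)
  moreover have "star (1 - z) = 1 - z" "h * (1 - z) = (1 - z) * h"
    using z(1) by (simp_all add: s_def star_minus star_one algebra_simps)
  ultimately show ?thesis by blast
qed

text \<open>For small self-adjoint \<open>h\<close> and \<open>y = sqrt (1 - h\<^sup>2)\<close>, the element \<open>u = h + iy\<close> is unitary and
  \<open>2h = u + u\<^sup>*\<close>, so \<open>f h\<close> is the average of two elements of norm at most 1.  Scaling gives the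
  bound for all self-adjoint elements, and the C*-identity carries it to arbitrary ones.  The
  optimal constant is 1; any constant gives continuity.\<close>

lemma star_hom_norm_le:
  fixes f :: "'a::unital_cstar_algebra \<Rightarrow> 'b::unital_cstar_algebra"
  assumes f: "star_hom_on UNIV f"
  shows "norm (f x) \<le> 2 * norm x"
proof -
  have hom: "f 1 = 1" "f (x + y) = f x + f y" "f (x * y) = f x * f y" "f (star x) = star (f x)"
    "f (c *\<^sub>C x) = c *\<^sub>C f x" for x y c
    using f by (auto simp: star_hom_on_def)
  have small: "norm (f h) \<le> 1" if h: "star h = h" "norm h \<le> 1/2" for h
  proof -
    obtain y where y: "star y = y" "h * y = y * h" "y * y = 1 - h * h"
      using sqrt_one_minus_square_exists [OF h] by blast
    \<comment> \<open>the unitary \<open>exp (i arccos h)\<close> of the functional calculus\<close>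
    define u where "u = h + \<i> *\<^sub>C y"
    have su: "star u = h + (- \<i>) *\<^sub>C y" by (simp add: u_def star_add star_scaleC h y)
    have expand: "(h + a *\<^sub>C y) * (h + b *\<^sub>C y)
        = h * h + (a * b) *\<^sub>C (y * y) + (a + b) *\<^sub>C (h * y)" for a b
      by (simp add: distrib_left distrib_right mult_scaleC_left mult_scaleC_right
          scaleC_scaleC scaleC_add_left scaleC_add_right y(2) ac_simps)
    have "star u * u = h * h + y * y" "u * star u = h * h + y * y"
      unfolding su unfolding u_def expand by (simp_all add: scaleC_one scaleC_zero_left)
    then have "unitary u" by (simp add: unitary_def y(3))
    then have "unitary (f u)"
      unfolding unitary_def using hom by metis
    then have fu: "norm (f u) \<le> 1" by (rule norm_unitary_le)
    have "u + star u = h + h + (\<i> + (- \<i>)) *\<^sub>C y"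
      unfolding scaleC_add_left su by (simp add: u_def)
    then have "h + h = u + star u" by (simp add: scaleC_zero_left)
    then have "f h + f h = f u + star (f u)" by (metis hom(2,4))
    then have "2 * norm (f h) = norm (f u + star (f u))"
      by (metis norm_scaleR abs_numeral scaleR_2)
    also have "\<dots> \<le> 2" using norm_triangle_ineq [of "f u" "star (f u)"] fu by (simp add: norm_star)
    finally show ?thesis by simp
  qed
  have sa: "norm (f h) \<le> 2 * norm h" if h: "star h = h" for h
  proof (cases "h = 0")
    case True
    then show ?thesis using hom(2) [of 0 0] by simp
  next
    case False
    \<comment> \<open>the factor that scales \<open>h\<close> to norm \<open>1/2\<close>\<close>
    define r where "r = inverse (2 * norm h)"
    have "norm (f (complex_of_real r *\<^sub>C h)) \<le> 1"
      by (rule small) (use False in \<open>auto simp: star_scaleC h norm_scaleC r_def norm_inverse norm_mult\<close>)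
    then have "r * norm (f h) \<le> 1" by (simp add: hom norm_scaleC) (simp add: r_def)
    then show ?thesis using False by (simp add: r_def field_simps)
  qed
  have "(norm (f x))\<^sup>2 = norm (f (star x * x))" by (simp add: hom cstar_identity)
  also have "\<dots> \<le> 2 * (norm x)\<^sup>2"
    using sa [of "star x * x"] by (simp add: star_mult star_star cstar_identity)
  also have "\<dots> \<le> (2 * norm x)\<^sup>2" by (simp add: power_mult_distrib)
  finally show ?thesis by (rule power2_le_imp_le) simp
qed

lemma star_hom_bounded_linear:
  fixes f :: "'a::unital_cstar_algebra \<Rightarrow> 'b::unital_cstar_algebra"
  assumes f: "star_hom_on UNIV f"
  shows "bounded_linear f"
proof (rule bounded_linear_intro [where K = 2])
  show "f (x + y) = f x + f y" "f (r *\<^sub>R x) = r *\<^sub>R f x" for x y r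
    using f by (simp_all add: star_hom_on_def scaleR_scaleC)
  show "norm (f x) \<le> norm x * 2" for x
    using star_hom_norm_le [OF f, of x] by simp
qed

lemma star_hom_eq_on_generated:
  fixes f g :: "'a::unital_cstar_algebra \<Rightarrow> 'b::unital_cstar_algebra"
  assumes f: "star_hom_on UNIV f" and g: "star_hom_on UNIV g"
    and eq: "\<And>x. x \<in> X \<Longrightarrow> f x = g x" and z: "z \<in> cstar_generated X"
  shows "f z = g z"
proof -
  let ?E = "{x. f x = g x}"
  have "star_subalgebra ?E"
    using f g by (auto simp: star_subalgebra_def star_hom_on_def)
  moreover have "closed ?E"
    by (intro closed_Collect_eq linear_continuous_on star_hom_bounded_linear f g)
  ultimately show ?thesis using eq z by (auto simp: cstar_generated_def)
qed

lemma star_hom_maps_generated: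
  fixes f :: "'a::unital_cstar_algebra \<Rightarrow> 'b::unital_cstar_algebra"
  assumes f: "star_hom_on UNIV f"
    and X: "f ` X \<subseteq> cstar_generated Y" and z: "z \<in> cstar_generated X"
  shows "f z \<in> cstar_generated Y"
proof -
  let ?E = "f -` cstar_generated Y"
  note Y = star_subalgebra_cstar_generated [of Y]
  have "star_subalgebra ?E"
    using f Y(1) by (auto simp: star_subalgebra_def star_hom_on_def)
  moreover have "closed ?E"
    by (intro closed_vimage Y linear_continuous_on star_hom_bounded_linear f)
  moreover have "X \<subseteq> ?E" using X by blast
  ultimately have "z \<in> ?E" using z unfolding cstar_generated_def [of X] by blast
  then show ?thesis by simp
qed

section \<open>The flip-flop on the 2-adic ring algebra\<close>

lemma q2_relations_flip: "q2_relations (star Q2_U) (Q2_U * Q2_S2)"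
proof -
  have r: "star Q2_U * Q2_U = 1" "Q2_U * star Q2_U = 1" "star Q2_S2 * Q2_S2 = 1"
    "Q2_S2 * Q2_U = Q2_U * Q2_U * Q2_S2"
    "Q2_S2 * star Q2_S2 + Q2_U * Q2_S2 * star Q2_S2 * star Q2_U = 1"
    using q2_relations_Q2
    by (auto simp: q2_relations_def unitary_def isometry_def power2_eq_square)
  have c: "star Q2_U * (Q2_U * x) = x" "Q2_U * (star Q2_U * x) = x"
    "star Q2_S2 * (Q2_S2 * x) = x" for x
    using r by (simp_all add: mult.assoc [symmetric])
  have "Q2_U * (Q2_U * (Q2_S2 * star Q2_U)) = Q2_S2"
    by (metis r(2,4) mult.assoc mult_1_right)
  then have "star Q2_U * (star Q2_U * Q2_S2) = Q2_S2 * star Q2_U"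
    by (metis c(1))
  then have "Q2_U * Q2_S2 * star Q2_U = (star Q2_U)\<^sup>2 * (Q2_U * Q2_S2)"
    by (metis c mult.assoc power2_eq_square)
  then show ?thesis
    using r by (simp add: q2_relations_def unitary_def isometry_def star_mult star_star
        mult.assoc c add.commute)
qed

lemma flip_involution:
  assumes L: "star_hom_on UNIV L" "L Q2_U = star Q2_U" "L Q2_S2 = Q2_U * Q2_S2"
  shows "L (L x) = x"
proof (rule star_hom_eq_on_generated [of "\<lambda>x. L (L x)" "\<lambda>x. x" "{Q2_U, Q2_S2}"])
  have "star Q2_U * Q2_U = 1"
    using q2_relations_Q2 by (simp add: q2_relations_def unitary_def)
  then show "L (L x) = x" if "x \<in> {Q2_U, Q2_S2}" for x
    using that L by (auto simp: star_hom_on_def star_star mult.assoc [symmetric])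
qed (use L Q2_generated in \<open>auto simp: star_hom_on_def\<close>)

lemma flip_exists:
  "\<exists>L. star_automorphism L \<and> L Q2_U = star Q2_U \<and> L Q2_S2 = Q2_U * Q2_S2"
proof -
  obtain L where L: "star_hom_on UNIV L" "L Q2_U = star Q2_U" "L Q2_S2 = Q2_U * Q2_S2"
    using Q2_universal [OF q2_relations_flip] by blast
  have "bij L" by (rule o_bij [of L]) (use flip_involution [OF L] in auto)
  then show ?thesis using L by (auto simp: star_automorphism_on_def)
qed

lemma flip_extends_flip_flop:
  assumes L: "star_hom_on UNIV L" "L Q2_U = star Q2_U" "L Q2_S2 = Q2_U * Q2_S2"
  shows "flip_flop L"
proof -
  have LL: "L (L x) = x" for x by (rule flip_involution [OF L])
  have S2: "L Q2_S2 = Q2_S1" by (simp add: L Q2_S1_def)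
  then have S1: "L Q2_S1 = Q2_S2" using LL by metis
  have O2: "L z \<in> Cuntz_O2" if "z \<in> Cuntz_O2" for z
    using that star_subalgebra_cstar_generated(3) [of "{Q2_S1, Q2_S2}"] unfolding Cuntz_O2_def
    by (intro star_hom_maps_generated [OF L(1)]) (auto simp: S1 S2)
  have "bij_betw L Cuntz_O2 Cuntz_O2"
    by (rule bij_betw_byWitness [where f' = L]) (use LL O2 in auto)
  then show ?thesis
    using L(1) S1 S2 by (auto simp: flip_flop_def star_automorphism_on_def star_hom_on_def)
qed

section \<open>The canonical representation\<close>

text \<open>Each letter sends basis vectors of \<open>\<ell>\<^sup>2(\<int>)\<close> to basis vectors or to 0.  The map recorded here is
  the inverse of the motion of the basis vectors: it says from which coordinate of \<open>v\<close> the \<open>j\<close>-th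
  coordinate of the image of \<open>v\<close> is read off, with \<open>None\<close> standing for the coordinate 0.  In this
  form the action makes sense for all functions on \<open>\<int>\<close>, without any condition on the support.\<close>

fun letter_map :: "gen \<times> bool \<Rightarrow> int \<Rightarrow> int option" where
  "letter_map (Gen_U, False) j = Some (j - 1)"
| "letter_map (Gen_U, True) j = Some (j + 1)"
| "letter_map (Gen_S, False) j = (if even j then Some (j div 2) else None)"
| "letter_map (Gen_S, True) j = Some (2 * j)"

definition word_map :: "word \<Rightarrow> int \<Rightarrow> int option" where
  "word_map w = foldr (\<lambda>a f j. Option.bind (letter_map a j) f) (letters w) Some"

lemma word_map_0: "word_map 0 j = Some j"
  by (simp add: word_map_def zero_word_def)

lemma word_map_Cons: "word_map (Word (a # l)) j = Option.bind (letter_map a j) (word_map (Word l))"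
  by (simp add: word_map_def)

lemma word_map_add: "word_map (v + w) j = Option.bind (word_map v j) (word_map w)"
proof -
  have "word_map (Word l + w) j = Option.bind (word_map (Word l) j) (word_map w)" for l
  proof (induction l arbitrary: j)
    case Nil
    then show ?case by (simp add: word_map_def plus_word_def)
  next
    case (Cons a l)
    have "Word (a # l) + w = Word (a # (l @ letters w))" by (simp add: plus_word_def)
    moreover have "Word (l @ letters w) = Word l + w" by (simp add: plus_word_def)
    ultimately show ?case
      by (cases "letter_map a j") (simp_all add: word_map_Cons Cons)
  qed
  from this [of "letters v"] show ?thesis by simp
qed

text \<open>The adjoint of a partial isometry permuting basis vectors is its partial inverse.\<close>

lemma word_map_wstar: "word_map (wstar w) k = Some j \<longleftrightarrow> word_map w j = Some k"
proof -
  have "word_map (wstar (Word l)) k = Some j \<longleftrightarrow> word_map (Word l) j = Some k" for l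
  proof (induction l arbitrary: j k)
    case Nil
    then show ?case by (auto simp: wstar_def word_map_def)
  next
    case (Cons a l)
    obtain g b where a: "a = (g, b)" by force
    have 1: "letter_map (g, \<not> b) k = Some j \<longleftrightarrow> letter_map (g, b) j = Some k" for j k
      by (cases g; cases b) auto
    have "Word (a # l) = Word [a] + Word l" by (simp add: plus_word_def)
    then have "wstar (Word (a # l)) = wstar (Word l) + Word [(g, \<not> b)]"
      by (simp only: wstar_add) (simp add: wstar_def a)
    then have "word_map (wstar (Word (a # l))) k = Some j
        \<longleftrightarrow> (\<exists>i. word_map (Word l) i = Some k \<and> letter_map (g, \<not> b) i = Some j)"
      by (simp add: word_map_add bind_eq_Some_conv Cons) (simp add: word_map_def bind_eq_Some_conv)
    then show ?case by (auto simp: a word_map_Cons bind_eq_Some_conv 1)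
  qed
  from this [of "letters w"] show ?thesis by simp
qed

text \<open>This monotonicity is what separates the algebra from the orientation-reversing reflection
  \<open>k \<mapsto> -1-k\<close>.\<close>

lemma word_map_strict_mono:
  assumes "word_map w j = Some k" "word_map w j' = Some k'" "j < j'"
  shows "k < k'"
proof -
  have letter: "k < k'" if "letter_map a j = Some k" "letter_map a j' = Some k'" "j < j'"
    for a j j' k k'
    using that by (cases "(a, j)" rule: letter_map.cases) (auto split: if_splits elim!: evenE)
  have "k < k'" if "word_map (Word l) j = Some k" "word_map (Word l) j' = Some k'" "j < j'" for l
    using that
  proof (induction l arbitrary: j j')
    case (Cons a l)
    then show ?case by (auto simp: word_map_Cons bind_eq_Some_conv dest: letter)
  qed (simp add: word_map_def)
  from this [of "letters w"] show ?thesis using assms by simp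
qed

definition word_act :: "word \<Rightarrow> (int \<Rightarrow> complex) \<Rightarrow> int \<Rightarrow> complex" where
  "word_act w v j = (case word_map w j of None \<Rightarrow> 0 | Some k \<Rightarrow> v k)"

definition free_act :: "free \<Rightarrow> (int \<Rightarrow> complex) \<Rightarrow> int \<Rightarrow> complex" where
  "free_act f v j = (\<Sum>w\<in>Poly_Mapping.keys f. Poly_Mapping.lookup f w * word_act w v j)"

lemma word_act_linear:
  "word_act w (\<lambda>k. v k + v' k) = (\<lambda>j. word_act w v j + word_act w v' j)"
  "word_act w (\<lambda>k. c * v k) = (\<lambda>j. c * word_act w v j)"
  by (auto simp: word_act_def split: option.split)

lemma word_act_add: "word_act (v + w) x = word_act v (word_act w x)"
  by (auto simp: word_act_def word_map_add split: option.split)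

lemma free_act_single: "free_act (Poly_Mapping.single w c) v = (\<lambda>j. c * word_act w v j)"
  by (auto simp: free_act_def)

lemma free_act_add: "free_act (f + g) v = (\<lambda>j. free_act f v j + free_act g v j)"
proof
  fix j
  let ?A = "Poly_Mapping.keys f \<union> Poly_Mapping.keys g"
  have sup: "free_act h v j = (\<Sum>w\<in>?A. Poly_Mapping.lookup h w * word_act w v j)"
    if "Poly_Mapping.keys h \<subseteq> ?A" for h
    unfolding free_act_def by (rule sum.mono_neutral_left) (use that in \<open>auto simp: in_keys_iff\<close>)
  show "free_act (f + g) v j = free_act f v j + free_act g v j"
    using sup [of f] sup [of g] sup [of "f + g"] Poly_Mapping.keys_add [of f g]
    by (simp add: lookup_add distrib_right sum.distrib)
qed

lemma free_act_linear:
  "free_act f (\<lambda>k. v k + v' k) = (\<lambda>j. free_act f v j + free_act f v' j)"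
  "free_act f (\<lambda>k. c * v k) = (\<lambda>j. c * free_act f v j)"
  by (simp_all add: free_act_def word_act_linear distrib_left sum.distrib sum_distrib_left
      mult.left_commute fun_eq_iff)

lemma free_act_zero: "free_act f (\<lambda>_. 0) = (\<lambda>_. 0)"
  using free_act_linear(2) [of f 0 "\<lambda>_. 0"] by simp

lemma free_act_mult: "free_act (f * g) v = free_act f (free_act g v)"
proof (induction f rule: free_induct)
  case (single w c)
  show ?case
    by (induction g rule: free_induct)
      (simp_all add: distrib_left free_act_add free_act_linear mult_single free_act_single
        word_act_add word_act_linear mult.assoc mult.left_commute)
qed (simp add: distrib_right free_act_add)

lemma free_act_1: "free_act 1 v = v"
proof -
  have "free_act (Poly_Mapping.single 0 1) v = v"
    by (simp only: free_act_single) (simp add: word_act_def word_map_0)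
  then show ?thesis by simp
qed

lemma free_act_fconst: "free_act (fconst c * f) v = (\<lambda>j. c * free_act f v j)"
  unfolding free_act_mult
  by (simp add: fconst_def free_act_single word_act_def word_map_0)

lemma free_act_diff: "free_act (f - g) v = (\<lambda>j. free_act f v j - free_act g v j)"
  using free_act_add [of "f - g" g v] by (simp add: fun_eq_iff algebra_simps)

lemma free_act_gen:
  "free_act (fgen Gen_U) v = (\<lambda>j. v (j - 1))"
  "free_act (fstar (fgen Gen_U)) v = (\<lambda>j. v (j + 1))"
  "free_act (fgen Gen_S) v = (\<lambda>j. if even j then v (j div 2) else 0)"
  "free_act (fstar (fgen Gen_S)) v = (\<lambda>j. v (2 * j))"
  by (simp_all add: fgen_def free_act_single word_act_def word_map_def wstar_def fun_eq_iff)

lemma free_act_relators: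
  assumes "r \<in> q2_relators" shows "free_act r v = (\<lambda>_. 0)"
proof -
  \<comment> \<open>the arithmetic behind \<open>S\<^sub>2U = U\<^sup>2S\<^sub>2\<close>\<close>
  have "(j - 1 - 1) div 2 = j div 2 - 1" for j :: int by presburger
  then show ?thesis
    using assms
    by (auto simp: q2_relators_def Let_def power2_eq_square free_act_diff free_act_add
        free_act_mult free_act_1 free_act_gen)
qed

section \<open>The operator seminorm on finitely supported vectors\<close>

definition supp :: "(int \<Rightarrow> complex) \<Rightarrow> int set" where
  "supp v = {k. v k \<noteq> 0}"

definition l2inner :: "(int \<Rightarrow> complex) \<Rightarrow> (int \<Rightarrow> complex) \<Rightarrow> complex" where
  "l2inner v u = (\<Sum>k\<in>supp v. v k * cnj (u k))"

definition l2norm :: "(int \<Rightarrow> complex) \<Rightarrow> real" where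
  "l2norm v = L2_set (\<lambda>k. cmod (v k)) (supp v)"

lemma l2inner_superset:
  "finite A \<Longrightarrow> supp v \<subseteq> A \<Longrightarrow> l2inner v u = (\<Sum>k\<in>A. v k * cnj (u k))"
  unfolding l2inner_def by (rule sum.mono_neutral_left) (auto simp: supp_def)

lemma l2norm_superset:
  "finite A \<Longrightarrow> supp v \<subseteq> A \<Longrightarrow> l2norm v = L2_set (\<lambda>k. cmod (v k)) A"
  unfolding l2norm_def L2_set_def
  by (intro arg_cong [of _ _ sqrt] sum.mono_neutral_left) (auto simp: supp_def)

lemma l2norm_nonneg [simp]: "0 \<le> l2norm v"
  by (simp add: l2norm_def)

lemma finite_supp_add: "finite (supp v) \<Longrightarrow> finite (supp u) \<Longrightarrow> finite (supp (\<lambda>k. v k + u k))"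
  by (rule finite_subset [of _ "supp v \<union> supp u"]) (auto simp: supp_def)

lemma finite_supp_scale: "finite (supp v) \<Longrightarrow> finite (supp (\<lambda>k. c * v k))"
  by (rule finite_subset [of _ "supp v"]) (auto simp: supp_def)

lemma l2inner_self: "l2inner v v = complex_of_real ((l2norm v)\<^sup>2)"
proof -
  have "(l2norm v)\<^sup>2 = (\<Sum>k\<in>supp v. (cmod (v k))\<^sup>2)"
    by (simp add: l2norm_def L2_set_def sum_nonneg)
  then show ?thesis
    by (simp add: l2inner_def complex_norm_square [symmetric] del: of_real_power)
qed

lemma l2inner_add_left:
  assumes "finite (supp v)" "finite (supp v')"
  shows "l2inner (\<lambda>k. v k + v' k) u = l2inner v u + l2inner v' u"
proof -
  let ?A = "supp v \<union> supp v'"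
  have "supp (\<lambda>k. v k + v' k) \<subseteq> ?A" by (auto simp: supp_def)
  then show ?thesis
    using assms by (simp add: l2inner_superset [of ?A] distrib_right sum.distrib)
qed

lemma l2inner_scale_left: "finite (supp v) \<Longrightarrow> l2inner (\<lambda>k. c * v k) u = c * l2inner v u"
  using l2inner_superset [of "supp v" "\<lambda>k. c * v k" u]
  by (simp add: l2inner_def sum_distrib_left mult.assoc) (auto simp: supp_def)

lemma l2inner_add_right: "l2inner v (\<lambda>k. u k + u' k) = l2inner v u + l2inner v u'"
  by (simp add: l2inner_def distrib_left sum.distrib)

lemma l2inner_scale_right: "l2inner v (\<lambda>k. c * u k) = cnj c * l2inner v u"
  by (simp add: l2inner_def sum_distrib_left mult_ac)

lemma l2inner_Cauchy_Schwarz: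
  assumes "finite (supp v)" "finite (supp u)"
  shows "cmod (l2inner v u) \<le> l2norm v * l2norm u"
proof -
  let ?A = "supp v \<union> supp u"
  have "cmod (l2inner v u) \<le> (\<Sum>k\<in>?A. \<bar>cmod (v k)\<bar> * \<bar>cmod (u k)\<bar>)"
    using assms by (simp add: l2inner_superset [of ?A]) (rule sum_norm_le, simp add: norm_mult)
  also have "\<dots> \<le> L2_set (\<lambda>k. cmod (v k)) ?A * L2_set (\<lambda>k. cmod (u k)) ?A"
    by (rule L2_set_mult_ineq)
  finally show ?thesis using assms by (simp add: l2norm_superset [of ?A])
qed

lemma l2norm_triangle:
  assumes "finite (supp v)" "finite (supp u)"
  shows "l2norm (\<lambda>k. v k + u k) \<le> l2norm v + l2norm u"
proof -
  let ?A = "supp v \<union> supp u"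
  have "supp (\<lambda>k. v k + u k) \<subseteq> ?A" by (auto simp: supp_def)
  then have "l2norm (\<lambda>k. v k + u k) = L2_set (\<lambda>k. cmod (v k + u k)) ?A"
    using assms by (intro l2norm_superset) auto
  also have "\<dots> \<le> L2_set (\<lambda>k. cmod (v k) + cmod (u k)) ?A"
    by (intro L2_set_mono norm_triangle_ineq) auto
  also have "\<dots> \<le> L2_set (\<lambda>k. cmod (v k)) ?A + L2_set (\<lambda>k. cmod (u k)) ?A"
    by (rule L2_set_triangle_ineq)
  finally show ?thesis using assms by (simp add: l2norm_superset [of ?A])
qed

lemma l2norm_scale:
  assumes "finite (supp v)" shows "l2norm (\<lambda>k. c * v k) = cmod c * l2norm v"
proof -
  have "l2norm (\<lambda>k. c * v k) = L2_set (\<lambda>k. cmod (c * v k)) (supp v)"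
    using assms by (intro l2norm_superset) (auto simp: supp_def)
  then show ?thesis by (simp add: l2norm_def norm_mult L2_set_right_distrib)
qed

lemma l2norm_zero [simp]: "l2norm (\<lambda>_. 0) = 0"
  by (simp add: l2norm_def L2_set_def)

lemma cmod_le_l2norm:
  assumes "finite (supp v)" shows "cmod (v j) \<le> l2norm v"
proof -
  have "cmod (v j) \<le> L2_set (\<lambda>k. cmod (v k)) (insert j (supp v))"
    using assms by (intro member_le_L2_set) auto
  also have "\<dots> = l2norm v" using assms by (intro l2norm_superset [symmetric]) auto
  finally show ?thesis .
qed

text \<open>A word moves the coordinates of a vector injectively and erases the others; contractivity and
  the adjoint relation both follow by reindexing sums along this injection.\<close>

lemma word_act_supp:
  "inj_on (the \<circ> word_map w) (supp (word_act w v))"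
  "(the \<circ> word_map w) ` supp (word_act w v) \<subseteq> supp v"
  "j \<in> supp (word_act w v) \<Longrightarrow> word_act w v j = v (the (word_map w j))"
proof -
  have dom: "\<exists>k. word_map w j = Some k \<and> v k \<noteq> 0" if "j \<in> supp (word_act w v)" for j
    using that by (auto simp: supp_def word_act_def split: option.splits)
  show "inj_on (the \<circ> word_map w) (supp (word_act w v))"
  proof (rule inj_onI)
    fix j j' assume a: "j \<in> supp (word_act w v)" "j' \<in> supp (word_act w v)"
      "(the \<circ> word_map w) j = (the \<circ> word_map w) j'"
    then obtain k where "word_map w j = Some k" "word_map w j' = Some k" using dom by fastforce
    then show "j = j'" using word_map_strict_mono by (metis less_irrefl linorder_neqE)
  qed
  show "(the \<circ> word_map w) ` supp (word_act w v) \<subseteq> supp v" using dom by (fastforce simp: supp_def)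
  show "word_act w v j = v (the (word_map w j))" if "j \<in> supp (word_act w v)"
    using dom [OF that] by (auto simp: word_act_def)
qed

lemma finite_supp_word_act: "finite (supp v) \<Longrightarrow> finite (supp (word_act w v))"
  by (rule inj_on_finite [OF word_act_supp(1,2)])

lemma l2norm_word_act:
  assumes "finite (supp v)" shows "l2norm (word_act w v) \<le> l2norm v"
proof -
  let ?h = "the \<circ> word_map w" and ?S = "supp (word_act w v)"
  have "(\<Sum>j\<in>?S. (cmod (word_act w v j))\<^sup>2) = (\<Sum>j\<in>?S. (cmod (v (?h j)))\<^sup>2)"
    using word_act_supp(3) by (intro sum.cong) auto
  also have "\<dots> = (\<Sum>k\<in>?h ` ?S. (cmod (v k))\<^sup>2)"
    using sum.reindex [OF word_act_supp(1), of "\<lambda>k. (cmod (v k))\<^sup>2" w v] by simp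
  also have "\<dots> \<le> (\<Sum>k\<in>supp v. (cmod (v k))\<^sup>2)"
    using assms word_act_supp(2) by (intro sum_mono2) auto
  finally show ?thesis by (simp add: l2norm_def L2_set_def)
qed

lemma l2inner_word_act:
  assumes "finite (supp v)"
  shows "l2inner (word_act w v) u = l2inner v (word_act (wstar w) u)"
proof -
  let ?h = "the \<circ> word_map w" and ?S = "supp (word_act w v)"
  have "l2inner (word_act w v) u = (\<Sum>j\<in>?S. v (?h j) * cnj (word_act (wstar w) u (?h j)))"
    unfolding l2inner_def
  proof (rule sum.cong)
    fix j assume j: "j \<in> ?S"
    then obtain k where k: "word_map w j = Some k"
      by (auto simp: supp_def word_act_def split: option.splits)
    then have "word_map (wstar w) k = Some j" by (simp add: word_map_wstar)
    then show "word_act w v j * cnj (u j) = v (?h j) * cnj (word_act (wstar w) u (?h j))"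
      using k by (simp add: word_act_def)
  qed simp
  also have "\<dots> = (\<Sum>k\<in>?h ` ?S. v k * cnj (word_act (wstar w) u k))"
    using sum.reindex [OF word_act_supp(1), of "\<lambda>k. v k * cnj (word_act (wstar w) u k)" w v]
    by simp
  also have "\<dots> = l2inner v (word_act (wstar w) u)"
    unfolding l2inner_def
  proof (rule sum.mono_neutral_left [OF assms word_act_supp(2)], intro ballI)
    fix k assume k: "k \<in> supp v - ?h ` ?S"
    have "word_map (wstar w) k = None"
    proof (rule ccontr)
      assume "word_map (wstar w) k \<noteq> None"
      then obtain j where j: "word_map w j = Some k" by (auto simp: word_map_wstar)
      then have "j \<in> ?S" "?h j = k" using k by (auto simp: supp_def word_act_def)
      then show False using k by blast
    qed
    then show "v k * cnj (word_act (wstar w) u k) = 0" by (simp add: word_act_def)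
  qed
  finally show ?thesis .
qed

lemma finite_supp_free_act: "finite (supp v) \<Longrightarrow> finite (supp (free_act f v))"
  by (induction f rule: free_induct)
    (simp_all add: free_act_single free_act_add finite_supp_add finite_supp_scale
      finite_supp_word_act)

lemma l2inner_free_act:
  assumes "finite (supp v)"
  shows "l2inner (free_act f v) u = l2inner v (free_act (fstar f) u)"
  by (induction f rule: free_induct)
    (simp_all add: free_act_single free_act_add fstar_add l2inner_add_left l2inner_add_right
      l2inner_scale_left l2inner_scale_right l2inner_word_act finite_supp_word_act
      finite_supp_free_act assms)

lemma free_act_bounded:
  "\<exists>B\<ge>0. \<forall>v. finite (supp v) \<longrightarrow> l2norm (free_act f v) \<le> B * l2norm v"
proof (induction f rule: free_induct)
  case (single w c)
  show ?case
    by (rule exI [of _ "cmod c"])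
      (auto simp: free_act_single l2norm_scale finite_supp_word_act
        intro!: mult_left_mono l2norm_word_act)
next
  case (add f g)
  then obtain B C where B: "0 \<le> B" "\<forall>v. finite (supp v) \<longrightarrow> l2norm (free_act f v) \<le> B * l2norm v"
    and C: "0 \<le> C" "\<forall>v. finite (supp v) \<longrightarrow> l2norm (free_act g v) \<le> C * l2norm v" by blast
  have "l2norm (free_act (f + g) v) \<le> (B + C) * l2norm v" if v: "finite (supp v)" for v
  proof -
    have "l2norm (free_act (f + g) v) \<le> l2norm (free_act f v) + l2norm (free_act g v)"
      unfolding free_act_add by (intro l2norm_triangle finite_supp_free_act v)
    also have "\<dots> \<le> B * l2norm v + C * l2norm v" using B C v by (intro add_mono) auto
    finally show ?thesis by (simp add: distrib_right)
  qed
  then show ?case using B C by (intro exI [of _ "B + C"]) auto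
qed

text \<open>The least bound, rather than a supremum over the unit ball, so that the estimates below need no
  normalisation of vectors.\<close>

definition opnorm :: "free \<Rightarrow> real" where
  "opnorm f = Inf {B. 0 \<le> B \<and> (\<forall>v. finite (supp v) \<longrightarrow> l2norm (free_act f v) \<le> B * l2norm v)}"

lemma opnorm_nonneg: "0 \<le> opnorm f"
  unfolding opnorm_def by (rule cInf_greatest) (use free_act_bounded [of f] in auto)

lemma opnorm_least:
  assumes "0 \<le> B" "\<And>v. finite (supp v) \<Longrightarrow> l2norm (free_act f v) \<le> B * l2norm v"
  shows "opnorm f \<le> B"
  unfolding opnorm_def by (rule cInf_lower) (use assms in \<open>auto intro: bdd_belowI [of _ 0]\<close>)

lemma l2norm_free_act:
  assumes v: "finite (supp v)"
  shows "l2norm (free_act f v) \<le> opnorm f * l2norm v"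
proof (cases "l2norm v = 0")
  case True
  then show ?thesis using free_act_bounded [of f] v by force
next
  case False
  then have pos: "0 < l2norm v" using l2norm_nonneg [of v] by linarith
  have "l2norm (free_act f v) / l2norm v \<le> opnorm f"
    unfolding opnorm_def
    by (rule cInf_greatest) (use free_act_bounded [of f] v pos in \<open>auto simp: field_simps\<close>)
  then show ?thesis using pos by (simp add: field_simps)
qed

lemma opnorm_mult: "opnorm (f * g) \<le> opnorm f * opnorm g"
proof (rule opnorm_least)
  fix v assume v: "finite (supp v)"
  have "l2norm (free_act (f * g) v) \<le> opnorm f * l2norm (free_act g v)"
    unfolding free_act_mult by (intro l2norm_free_act finite_supp_free_act v)
  also have "\<dots> \<le> opnorm f * (opnorm g * l2norm v)"
    by (intro mult_left_mono l2norm_free_act v opnorm_nonneg)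
  finally show "l2norm (free_act (f * g) v) \<le> opnorm f * opnorm g * l2norm v"
    by (simp add: mult.assoc)
qed (simp add: opnorm_nonneg)

lemma l2norm_free_act_square:
  assumes v: "finite (supp v)"
  shows "(l2norm (free_act f v))\<^sup>2 \<le> opnorm (fstar f * f) * (l2norm v)\<^sup>2"
proof -
  have "complex_of_real ((l2norm (free_act f v))\<^sup>2) = l2inner v (free_act (fstar f * f) v)"
    by (simp only: l2inner_self [symmetric] l2inner_free_act [OF v] free_act_mult)
  then have "(l2norm (free_act f v))\<^sup>2 = cmod (l2inner v (free_act (fstar f * f) v))"
    by (metis norm_of_real abs_of_nonneg zero_le_power2)
  also have "\<dots> \<le> l2norm v * l2norm (free_act (fstar f * f) v)"
    by (intro l2inner_Cauchy_Schwarz finite_supp_free_act v)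
  also have "\<dots> \<le> l2norm v * (opnorm (fstar f * f) * l2norm v)"
    by (intro mult_left_mono l2norm_free_act v) simp
  finally show ?thesis by (simp add: power2_eq_square mult_ac)
qed

text \<open>The nontrivial half of the C*-identity, from
  \<open>\<parallel>fv\<parallel>\<^sup>2 = \<langle>v, f\<^sup>*f v\<rangle> \<le> \<parallel>f\<^sup>*f\<parallel> \<parallel>v\<parallel>\<^sup>2\<close>.\<close>

lemma opnorm_square_le: "(opnorm f)\<^sup>2 \<le> opnorm (fstar f * f)"
proof -
  have "opnorm f \<le> sqrt (opnorm (fstar f * f))"
  proof (rule opnorm_least)
    fix v assume v: "finite (supp v)"
    show "l2norm (free_act f v) \<le> sqrt (opnorm (fstar f * f)) * l2norm v"
      by (rule power2_le_imp_le)
        (use l2norm_free_act_square [OF v, of f] opnorm_nonneg in \<open>auto simp: power_mult_distrib\<close>)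
  qed (simp add: opnorm_nonneg)
  then have "(opnorm f)\<^sup>2 \<le> (sqrt (opnorm (fstar f * f)))\<^sup>2"
    by (intro power_mono opnorm_nonneg)
  then show ?thesis by (simp add: opnorm_nonneg)
qed

lemma opnorm_fstar: "opnorm (fstar f) = opnorm f"
proof -
  have le: "opnorm f \<le> opnorm (fstar f)" for f
  proof (cases "opnorm f = 0")
    case False
    then have "0 < opnorm f" using opnorm_nonneg [of f] by linarith
    moreover have "opnorm f * opnorm f \<le> opnorm (fstar f) * opnorm f"
      using opnorm_square_le [of f] opnorm_mult [of "fstar f" f] by (simp add: power2_eq_square)
    ultimately show ?thesis by simp
  qed (simp add: opnorm_nonneg)
  show ?thesis using le [of f] le [of "fstar f"] by simp
qed

lemma q2_seminorm_opnorm: "q2_seminorm opnorm"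
  unfolding q2_seminorm_def
proof (intro conjI allI ballI)
  fix f g :: free and c :: complex
  show "opnorm (f + g) \<le> opnorm f + opnorm g"
  proof (rule opnorm_least)
    fix v assume v: "finite (supp v)"
    have "l2norm (free_act (f + g) v) \<le> l2norm (free_act f v) + l2norm (free_act g v)"
      unfolding free_act_add by (intro l2norm_triangle finite_supp_free_act v)
    also have "\<dots> \<le> opnorm f * l2norm v + opnorm g * l2norm v"
      by (intro add_mono l2norm_free_act v)
    finally show "l2norm (free_act (f + g) v) \<le> (opnorm f + opnorm g) * l2norm v"
      by (simp add: distrib_right)
  qed (simp add: opnorm_nonneg)
  have le: "opnorm (fconst c * f) \<le> cmod c * opnorm f" for c f
    by (rule opnorm_least)
      (auto simp: opnorm_nonneg free_act_fconst l2norm_scale finite_supp_free_act mult.assoc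
        intro!: mult_left_mono l2norm_free_act)
  show "opnorm (fconst c * f) = cmod c * opnorm f"
  proof (cases "c = 0")
    case True
    then show ?thesis using le [of 0 f] opnorm_nonneg [of 0] by simp
  next
    case False
    have "f = fconst (inverse c) * (fconst c * f)"
      using False by (simp add: mult.assoc [symmetric] fconst_mult [symmetric])
    then have "opnorm f \<le> cmod (inverse c) * opnorm (fconst c * f)" using le by metis
    then have "cmod c * opnorm f \<le> opnorm (fconst c * f)"
      using False by (simp add: norm_inverse norm_divide field_simps)
    then show ?thesis using le [of c f] by simp
  qed
  show "opnorm (f * g) \<le> opnorm f * opnorm g" by (rule opnorm_mult)
  show "opnorm (fstar f * f) = (opnorm f)\<^sup>2"
    using opnorm_mult [of "fstar f" f] opnorm_square_le [of f]
    by (simp add: opnorm_fstar power2_eq_square)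
next
  fix r assume "r \<in> q2_relators"
  then have "opnorm r \<le> 0" by (intro opnorm_least) (simp_all add: free_act_relators)
  then show "opnorm r = 0" using opnorm_nonneg [of r] by simp
qed

section \<open>Matrix coefficients\<close>

definition unit_vec :: "int \<Rightarrow> int \<Rightarrow> complex" where
  "unit_vec k = (\<lambda>j. if j = k then 1 else 0)"

lemma free_act_unit_vec_le: "cmod (free_act f (unit_vec k) j) \<le> q2_norm f"
proof -
  have supp: "supp (unit_vec k) = {k}" by (auto simp: supp_def unit_vec_def)
  have "cmod (free_act f (unit_vec k) j) \<le> l2norm (free_act f (unit_vec k))"
    by (intro cmod_le_l2norm finite_supp_free_act) (simp add: supp)
  also have "\<dots> \<le> opnorm f * l2norm (unit_vec k)"
    by (intro l2norm_free_act) (simp add: supp)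
  also have "l2norm (unit_vec k) = 1" by (simp add: l2norm_def supp) (simp add: unit_vec_def)
  finally show ?thesis using q2_norm_upper [OF q2_seminorm_opnorm, of f] by simp
qed

lemma q2_obtain_sequence:
  obtains X where "(\<lambda>n. of_free (X n)) \<longlonglongrightarrow> z"
  using q2_cases [of z] of_free_tendsto by metis

text \<open>A functional dominated by the universal seminorm is constant on classes and maps Cauchy
  sequences to Cauchy sequences, so its value at \<open>z\<close> is the limit along any approximating sequence.\<close>

lemma free_functional_extends:
  fixes m :: "free \<Rightarrow> complex"
  assumes add: "\<And>x y. m (x + y) = m x + m y"
    and scale: "\<And>c x. m (fconst c * x) = c * m x"
    and bound: "\<And>x. cmod (m x) \<le> q2_norm x"
  shows "\<exists>\<phi>. bounded_linear \<phi> \<and> (\<forall>x. \<phi> (of_free x) = m x) \<and> (\<forall>z. cmod (\<phi> z) \<le> norm z)"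
proof -
  have diff: "cmod (m x - m y) \<le> norm (of_free x - of_free y)" for x y
  proof -
    have "m x - m y = m (x - y)" using add [of "x - y" y] by simp
    then show ?thesis using bound [of "x - y"] by (simp add: norm_of_free of_free_hom [symmetric])
  qed
  have conv: "convergent (\<lambda>n. m (X n))" if X: "(\<lambda>n. of_free (X n)) \<longlonglongrightarrow> z" for X z
  proof -
    have "Cauchy (\<lambda>n. of_free (X n))" using X LIMSEQ_imp_Cauchy by blast
    then have "Cauchy (\<lambda>n. m (X n))"
      unfolding Cauchy_def dist_norm using le_less_trans [OF diff] by fast
    then show ?thesis by (rule Cauchy_convergent)
  qed
  define \<phi> where "\<phi> z = lim (\<lambda>n. m ((SOME X. (\<lambda>n. of_free (X n)) \<longlonglongrightarrow> z) n))" for z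
  have lim: "(\<lambda>n. m (X n)) \<longlonglongrightarrow> \<phi> z" if X: "(\<lambda>n. of_free (X n)) \<longlonglongrightarrow> z" for X z
  proof -
    define Y where "Y = (SOME X. (\<lambda>n. of_free (X n)) \<longlonglongrightarrow> z)"
    have Y: "(\<lambda>n. of_free (Y n)) \<longlonglongrightarrow> z"
      unfolding Y_def by (rule someI [of "\<lambda>X. (\<lambda>n. of_free (X n)) \<longlonglongrightarrow> z", OF X])
    then have mY: "(\<lambda>n. m (Y n)) \<longlonglongrightarrow> \<phi> z"
      using conv [OF Y] by (simp add: convergent_LIMSEQ_iff \<phi>_def Y_def)
    have "(\<lambda>n. norm (of_free (X n) - of_free (Y n))) \<longlonglongrightarrow> 0"
      using tendsto_norm [OF tendsto_diff [OF X Y]] by simp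
    then have "(\<lambda>n. cmod (m (X n) - m (Y n))) \<longlonglongrightarrow> 0"
      by (rule tendsto_0_le) (simp_all add: diff)
    then have "(\<lambda>n. m (X n) - m (Y n)) \<longlonglongrightarrow> 0" by (rule tendsto_norm_zero_cancel)
    from tendsto_add [OF this mY] show ?thesis by simp
  qed
  have \<phi>_free: "\<phi> (of_free x) = m x" for x
    using lim [of "\<lambda>_. x"] by (simp add: LIMSEQ_const_iff)
  have \<phi>_le: "cmod (\<phi> z) \<le> norm z" for z
  proof -
    obtain X where X: "(\<lambda>n. of_free (X n)) \<longlonglongrightarrow> z" by (rule q2_obtain_sequence)
    show ?thesis
      by (rule LIMSEQ_le [OF tendsto_norm [OF lim [OF X]] tendsto_norm [OF X]])
        (simp add: norm_of_free bound)
  qed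
  have "bounded_linear \<phi>"
  proof (rule bounded_linear_intro [where K = 1])
    fix y z :: q2 and r :: real
    obtain X where X: "(\<lambda>n. of_free (X n)) \<longlonglongrightarrow> y" by (rule q2_obtain_sequence)
    obtain Y where Y: "(\<lambda>n. of_free (Y n)) \<longlonglongrightarrow> z" by (rule q2_obtain_sequence)
    have "(\<lambda>n. m (X n + Y n)) \<longlonglongrightarrow> \<phi> (y + z)"
      using tendsto_add [OF X Y] by (intro lim) (simp add: of_free_hom)
    then show "\<phi> (y + z) = \<phi> y + \<phi> z"
      using tendsto_add [OF lim [OF X] lim [OF Y]] by (simp add: add LIMSEQ_unique)
    have "(\<lambda>n. m (fconst (complex_of_real r) * X n)) \<longlonglongrightarrow> \<phi> (r *\<^sub>R y)"
      using tendsto_scaleR [OF tendsto_const X, of r]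
      by (intro lim) (simp add: of_free_hom(7) scaleR_scaleC)
    then show "\<phi> (r *\<^sub>R y) = r *\<^sub>R \<phi> y"
      using tendsto_mult [OF tendsto_const lim [OF X], of "complex_of_real r"]
      by (simp add: scale LIMSEQ_unique scaleR_conv_of_real)
  qed (simp add: \<phi>_le)
  then show ?thesis using \<phi>_free \<phi>_le by blast
qed

text \<open>The coefficient \<open>\<langle>z e\<^sub>k, e\<^sub>j\<rangle>\<close> in the canonical representation, obtained as the continuous
  extension from the image of the free *-algebra.\<close>

definition mat_coeff :: "int \<Rightarrow> int \<Rightarrow> q2 \<Rightarrow> complex" where
  "mat_coeff j k = (SOME \<phi>. bounded_linear \<phi> \<and> (\<forall>f. \<phi> (of_free f) = free_act f (unit_vec k) j) \<and>
     (\<forall>z. cmod (\<phi> z) \<le> norm z))"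

lemma
  shows bounded_linear_mat_coeff: "bounded_linear (mat_coeff j k)"
    and mat_coeff_of_free: "mat_coeff j k (of_free f) = free_act f (unit_vec k) j"
    and cmod_mat_coeff_le: "cmod (mat_coeff j k z) \<le> norm z"
proof -
  have "\<exists>\<phi>. bounded_linear \<phi> \<and> (\<forall>f. \<phi> (of_free f) = free_act f (unit_vec k) j) \<and>
      (\<forall>z. cmod (\<phi> z) \<le> norm z)"
    by (rule free_functional_extends) (simp_all add: free_act_add free_act_fconst free_act_unit_vec_le)
  from someI_ex [OF this]
  show "bounded_linear (mat_coeff j k)" "mat_coeff j k (of_free f) = free_act f (unit_vec k) j"
    "cmod (mat_coeff j k z) \<le> norm z"
    unfolding mat_coeff_def by blast+
qed

lemmas continuous_on_mat_coeff [continuous_intros] =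
  bounded_linear.continuous_on [OF bounded_linear_mat_coeff]

lemma continuous_eq_on_of_free:
  fixes f g :: "q2 \<Rightarrow> complex"
  assumes "continuous_on UNIV f" "continuous_on UNIV g" "\<And>x. f (of_free x) = g (of_free x)"
  shows "f z = g z"
proof -
  obtain X where X: "(\<lambda>n. of_free (X n)) \<longlonglongrightarrow> z" by (rule q2_obtain_sequence)
  have "closed {z. f z = g z}" using assms by (intro closed_Collect_eq)
  from closed_sequentially [OF this _ X] show ?thesis using assms(3) by simp
qed

text \<open>The \<open>k\<close>-th column of a product is the left factor applied to the \<open>k\<close>-th column of the right
  factor.  For a left factor from the free *-algebra this involves finitely many entries of the
  column only, so it survives passing to the limit in \<open>y\<close>.\<close>

lemma mat_coeff_mult_left:
  "mat_coeff j k (of_free f * y) = free_act f (\<lambda>i. mat_coeff i k y) j"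
proof (rule continuous_eq_on_of_free
    [of "\<lambda>y. mat_coeff j k (of_free f * y)" "\<lambda>y. free_act f (\<lambda>i. mat_coeff i k y) j" y])
  have "continuous_on UNIV (\<lambda>y. word_act w (\<lambda>i. mat_coeff i k y) j)" for w
    by (cases "word_map w j") (simp_all add: word_act_def continuous_intros)
  then show "continuous_on UNIV (\<lambda>y. free_act f (\<lambda>i. mat_coeff i k y) j)"
    unfolding free_act_def by (intro continuous_intros)
  show "continuous_on UNIV (\<lambda>y. mat_coeff j k (of_free f * y))" by (intro continuous_intros)
  show "mat_coeff j k (of_free f * of_free g) = free_act f (\<lambda>i. mat_coeff i k (of_free g)) j" for g
    by (simp add: of_free_hom(4) [symmetric] mat_coeff_of_free free_act_mult)
qed

lemma mat_coeff_mult_right: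
  assumes "free_act f (unit_vec k) = unit_vec l"
  shows "mat_coeff j k (y * of_free f) = mat_coeff j l y"
proof (rule continuous_eq_on_of_free [of "\<lambda>y. mat_coeff j k (y * of_free f)" "mat_coeff j l" y])
  show "mat_coeff j k (of_free g * of_free f) = mat_coeff j l (of_free g)" for g
    by (simp add: of_free_hom(4) [symmetric] mat_coeff_of_free free_act_mult assms)
qed (intro continuous_intros)+

lemma mat_coeff_one: "mat_coeff j k 1 = unit_vec k j"
  using mat_coeff_of_free [of j k 1] by (simp add: of_free_hom free_act_1)

text \<open>The elements whose \<open>k\<close>-th column vanishes form a left ideal, the annihilator of \<open>e\<^sub>k\<close>.\<close>

lemma mat_coeff_zero_imp_mult_zero:
  assumes "\<And>i. mat_coeff i k y = 0"
  shows "mat_coeff j k (a * y) = 0"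
proof (rule continuous_eq_on_of_free [of "\<lambda>a. mat_coeff j k (a * y)" "\<lambda>_. 0" a])
  show "mat_coeff j k (of_free f * y) = 0" for f
    by (simp add: mat_coeff_mult_left assms free_act_zero)
qed (intro continuous_intros)+

text \<open>If a single word had nonzero coefficients for two indices \<open>k < k'\<close>, its increasing partial map
  would send \<open>-1-k' < -1-k\<close> to \<open>k' > k\<close>, which is impossible.\<close>

lemma finite_antidiagonal_coeff: "finite {k. free_act f (unit_vec k) (- 1 - k) \<noteq> 0}"
proof (induction f rule: free_induct)
  case (single w c)
  let ?A = "{k. word_map w (- 1 - k) = Some k}"
  have "\<not> k < k'" if "k \<in> ?A" "k' \<in> ?A" for k k'
    using that word_map_strict_mono [of w "- 1 - k'" k' "- 1 - k" k] by auto
  then have "k = k'" if "k \<in> ?A" "k' \<in> ?A" for k k' using that by (meson linorder_neqE)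
  then have "?A \<subseteq> {SOME k. k \<in> ?A}" using someI [of "\<lambda>k. k \<in> ?A"] by blast
  then have "finite ?A" using finite_subset by blast
  moreover have "{k. free_act (Poly_Mapping.single w c) (unit_vec k) (- 1 - k) \<noteq> 0} \<subseteq> ?A"
    by (auto simp: free_act_single word_act_def unit_vec_def split: option.splits if_splits)
  ultimately show ?case by (rule rev_finite_subset)
next
  case (add f g)
  then have "finite ({k. free_act f (unit_vec k) (- 1 - k) \<noteq> 0}
      \<union> {k. free_act g (unit_vec k) (- 1 - k) \<noteq> 0})" by simp
  then show ?case by (rule rev_finite_subset) (auto simp: free_act_add)
qed

section \<open>Outerness\<close>

text \<open>In terms of \<open>g(n) = \<langle>w e\<^sub>0, e\<^sub>n\<rangle>\<close> the two relations say \<open>\<langle>w e\<^sub>k, e\<^sub>j\<rangle> = g(j + k)\<close>,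
  \<open>g(2n) = 0\<close> and \<open>g(2n + 1) = g(n)\<close>.  The map \<open>n \<mapsto> 2n + 1\<close> has the fixed point \<open>-1\<close>, and every
  other \<open>n\<close> is reached from an even number by iterating it.\<close>

lemma intertwiner_mat_coeff_zero:
  assumes U: "w * Q2_U = star Q2_U * w" and S: "w * Q2_S2 = Q2_U * Q2_S2 * w"
  shows "mat_coeff j k w = 0"
proof -
  have shift: "mat_coeff j (k + 1) w = mat_coeff (j + 1) k w" for j k
  proof -
    have "mat_coeff j (k + 1) w = mat_coeff j k (w * Q2_U)"
      unfolding Q2_U_def
      by (rule mat_coeff_mult_right [symmetric]) (auto simp: free_act_gen unit_vec_def)
    also have "\<dots> = mat_coeff j k (of_free (fstar (fgen Gen_U)) * w)"
      by (simp only: U) (simp add: Q2_U_def of_free_hom)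
    also have "\<dots> = mat_coeff (j + 1) k w" by (simp add: mat_coeff_mult_left free_act_gen)
    finally show ?thesis .
  qed
  have antidiag: "mat_coeff j k w = mat_coeff (j + k) 0 w" for j k
  proof (induction k arbitrary: j rule: int_induct [where k = 0])
    case (step1 i)
    then show ?case using shift [of j i] by (simp add: algebra_simps)
  next
    case (step2 i)
    then show ?case using shift [of "j - 1" "i - 1"] by (simp add: algebra_simps)
  qed simp
  have dilate: "mat_coeff j 0 w = (if even j then 0 else mat_coeff ((j - 1) div 2) 0 w)" for j
  proof -
    have "mat_coeff j 0 w = mat_coeff j 0 (w * Q2_S2)"
      unfolding Q2_S2_def
      by (rule mat_coeff_mult_right [symmetric])
        (auto simp: free_act_gen unit_vec_def fun_eq_iff elim!: evenE)
    also have "\<dots> = mat_coeff j 0 (of_free (fgen Gen_U * fgen Gen_S) * w)"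
      by (simp only: S) (simp add: Q2_U_def Q2_S2_def of_free_hom)
    also have "\<dots> = (if even j then 0 else mat_coeff ((j - 1) div 2) 0 w)"
      by (simp add: mat_coeff_mult_left free_act_mult free_act_gen)
    finally show ?thesis .
  qed
  \<comment> \<open>centring at the fixed point, \<open>n = t - 1\<close>, turns the recursion into halving \<open>t\<close>\<close>
  have off: "mat_coeff (t - 1) 0 w = 0" if "t \<noteq> 0" for t
    using that
  proof (induction "nat \<bar>t\<bar>" arbitrary: t rule: less_induct)
    case less
    show ?case
    proof (cases "even t")
      case True
      then obtain s where s: "t = 2 * s" by blast
      then have "mat_coeff (s - 1) 0 w = 0" using less by auto
      moreover have "(t - 1 - 1) div 2 = s - 1" using s by simp
      ultimately show ?thesis using dilate [of "t - 1"] by simp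
    next
      case False
      then show ?thesis using dilate [of "t - 1"] by simp
    qed
  qed
  \<comment> \<open>\<open>w\<close> is constant along \<open>j + k = -1\<close>, whereas the approximant vanishes somewhere on it\<close>
  have "cmod (mat_coeff (- 1) 0 w) \<le> e" if e: "e > 0" for e
  proof -
    obtain f where f: "dist (of_free f) w < e" using of_free_dense [OF e] by blast
    obtain k where k: "free_act f (unit_vec k) (- 1 - k) = 0"
      using ex_new_if_finite [OF _ finite_antidiagonal_coeff [of f]] infinite_UNIV_int by auto
    have "mat_coeff (- 1 - k) k (of_free f - w) = - mat_coeff (- 1) 0 w"
      using antidiag [of "- 1 - k" k]
      by (simp add: bounded_linear.linear [OF bounded_linear_mat_coeff] linear_diff mat_coeff_of_free k)
    then show ?thesis
      using cmod_mat_coeff_le [of "- 1 - k" k "of_free f - w"] f by (simp add: dist_norm)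
  qed
  then have "cmod (mat_coeff (- 1) 0 w) \<le> 0" by (rule field_le_epsilon [of _ 0, simplified])
  then show ?thesis using antidiag [of j k] off [of "j + k + 1"] by (cases "j + k = - 1") auto
qed

lemma flip_not_inner:
  assumes L: "L Q2_U = star Q2_U" "L Q2_S2 = Q2_U * Q2_S2"
  shows "\<not> inner_automorphism L"
proof
  assume "inner_automorphism L"
  then obtain w where w: "star w * w = 1" and Lw: "\<And>x. L x = w * x * star w"
    by (auto simp: inner_automorphism_def unitary_def)
  have comm: "w * x = L x * w" for x by (simp add: Lw mult.assoc w)
  have "mat_coeff j k w = 0" for j k
    by (rule intertwiner_mat_coeff_zero) (simp_all add: comm L)
  then have "mat_coeff 0 0 (star w * w) = 0" by (rule mat_coeff_zero_imp_mult_zero)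
  then show False by (simp add: w mat_coeff_one unit_vec_def)
qed

lemma flip_unique:
  assumes L: "star_hom_on UNIV L" "L Q2_U = star Q2_U" "L Q2_S2 = Q2_U * Q2_S2"
    and M: "star_hom_on UNIV M" "M Q2_U = star Q2_U" "M Q2_S2 = Q2_U * Q2_S2"
  shows "L = M"
proof
  fix x
  have gen: "L y = M y" if "y \<in> {Q2_U, Q2_S2}" for y using that L(2,3) M(2,3) by auto
  show "L x = M x"
    by (rule star_hom_eq_on_generated [OF L(1) M(1) gen, where X = "{Q2_U, Q2_S2}"])
      (use Q2_generated in auto)
qed

theorem theorem5p8:
  shows "(\<exists>!L :: q2 \<Rightarrow> q2. star_automorphism L \<and> L Q2_U = star Q2_U \<and> L Q2_S2 = Q2_U * Q2_S2) \<and>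
    (\<forall>L :: q2 \<Rightarrow> q2. star_automorphism L \<and> L Q2_U = star Q2_U \<and> L Q2_S2 = Q2_U * Q2_S2 \<longrightarrow>
       flip_flop L \<and> outer_automorphism L)"
proof
  show "\<exists>!L. star_automorphism L \<and> L Q2_U = star Q2_U \<and> L Q2_S2 = Q2_U * Q2_S2"
  proof (rule ex_ex1I [OF flip_exists])
    fix L M :: "q2 \<Rightarrow> q2"
    assume "star_automorphism L \<and> L Q2_U = star Q2_U \<and> L Q2_S2 = Q2_U * Q2_S2"
      and "star_automorphism M \<and> M Q2_U = star Q2_U \<and> M Q2_S2 = Q2_U * Q2_S2"
    then show "L = M" unfolding star_automorphism_on_def by (intro flip_unique) blast+
  qed
  show "\<forall>L. star_automorphism L \<and> L Q2_U = star Q2_U \<and> L Q2_S2 = Q2_U * Q2_S2 \<longrightarrow>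
       flip_flop L \<and> outer_automorphism L"
  proof (intro allI impI)
    fix L :: "q2 \<Rightarrow> q2"
    assume L: "star_automorphism L \<and> L Q2_U = star Q2_U \<and> L Q2_S2 = Q2_U * Q2_S2"
    then have "flip_flop L"
      unfolding star_automorphism_on_def by (intro flip_extends_flip_flop) blast+
    moreover have "outer_automorphism L"
      using L flip_not_inner unfolding outer_automorphism_def by blast
    ultimately show "flip_flop L \<and> outer_automorphism L" by blast
  qed
qed

end
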